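(* Let $K$ be a compact Hausdorff space that contains a Cantor set as a subspace. Then there exists a uniform algebra $A$ on $K$ such that $\mathfrak{M}_A\setminus K\neq\emptyset$ but $\mathfrak{M}_A$ contains no analytic discs.
   Context: A uniform algebra on a compact Hausdorff space $K$ is a closed subalgebra of $C(K)$ (supremum norm) that contains the constants and separates points of $K$. $\mathfrak{M}_A$ denotes the maximal ideal space of $A$ (the space of nonzero multiplicative linear functionals with the Gelfand topology); $K$ is regarded as a subset of $\mathfrak{M}_A$ via point evaluations. An analytic disc in $\mathfrak{M}_A$ is an injective map $\sigma:D\to\mathfrak{M}_A$ ($D$ the open unit disc) such that $\hat f\circ\sigma$ is holomorphic on $D$ for every $f\in A$, where $\hat f$ is the Gelfand transform; $\mathfrak{M}_A$ contains no analytic discs if no such map exists. *)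

theory Defs
  imports "HOL-Analysis.Analysis"
begin

text \<open>The compact Hausdorff space K is modelled as a type 'a of class t2_space
  whose universe is compact; C(K) is the set of continuous functions 'a to complex.\<close>

definition cantor_set :: "real set" where
  "cantor_set = {x. \<exists>d::nat \<Rightarrow> nat. (\<forall>n. d n \<in> {0, 2}) \<and>
                      x = (\<Sum>n. real (d n) / 3 ^ Suc n)}"

definition uniform_algebra :: "('a::topological_space \<Rightarrow> complex) set \<Rightarrow> bool" where
  "uniform_algebra A \<longleftrightarrow>
     (\<forall>f\<in>A. continuous_on UNIV f) \<and>
     (\<forall>c. (\<lambda>_. c) \<in> A) \<and>
     (\<forall>f\<in>A. \<forall>g\<in>A. (\<lambda>x. f x + g x) \<in> A) \<and>
     (\<forall>f\<in>A. \<forall>g\<in>A. (\<lambda>x. f x * g x) \<in> A) \<and>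
     (\<forall>c. \<forall>f\<in>A. (\<lambda>x. c * f x) \<in> A) \<and>
     (\<forall>F g. (\<forall>n. F n \<in> A) \<and> uniform_limit UNIV F g sequentially \<longrightarrow> g \<in> A) \<and>
     (\<forall>x y. x \<noteq> y \<longrightarrow> (\<exists>f\<in>A. f x \<noteq> f y))"

text \<open>Elements of the maximal ideal space: nonzero multiplicative complex-linear
  functionals on A (only their values on A matter).\<close>
definition character :: "('a \<Rightarrow> complex) set \<Rightarrow> (('a \<Rightarrow> complex) \<Rightarrow> complex) \<Rightarrow> bool" where
  "character A \<phi> \<longleftrightarrow>
     (\<forall>f\<in>A. \<forall>g\<in>A. \<phi> (\<lambda>x. f x + g x) = \<phi> f + \<phi> g) \<and>
     (\<forall>c. \<forall>f\<in>A. \<phi> (\<lambda>x. c * f x) = c * \<phi> f) \<and>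
     (\<forall>f\<in>A. \<forall>g\<in>A. \<phi> (\<lambda>x. f x * g x) = \<phi> f * \<phi> g) \<and>
     (\<exists>f\<in>A. \<phi> f \<noteq> 0)"

definition is_point_evaluation :: "('a \<Rightarrow> complex) set \<Rightarrow> (('a \<Rightarrow> complex) \<Rightarrow> complex) \<Rightarrow> bool" where
  "is_point_evaluation A \<phi> \<longleftrightarrow> (\<exists>x. \<forall>f\<in>A. \<phi> f = f x)"

text \<open>An analytic disc in the maximal ideal space: an injective map from the open
  unit disc into the characters (functionals identified when they agree on A) such
  that every Gelfand transform composed with it is holomorphic.\<close>
definition analytic_disc :: "('a \<Rightarrow> complex) set \<Rightarrow> (complex \<Rightarrow> ('a \<Rightarrow> complex) \<Rightarrow> complex) \<Rightarrow> bool" where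
  "analytic_disc A \<sigma> \<longleftrightarrow>
     (\<forall>z\<in>ball 0 1. character A (\<sigma> z)) \<and>
     (\<forall>z\<in>ball 0 1. \<forall>w\<in>ball 0 1. z \<noteq> w \<longrightarrow> (\<exists>f\<in>A. \<sigma> z f \<noteq> \<sigma> w f)) \<and>
     (\<forall>f\<in>A. (\<lambda>z. \<sigma> z f) holomorphic_on ball 0 1)"

end

theory Submission
  imports Defs "HOL-Complex_Analysis.Complex_Analysis"
begin

text \<open>
  If every element of a dense set of functions has a square root in that set, then on an analytic disc
  the order of a zero is divisible by every power of two, so all functions are constant and there is no
  disc. It therefore suffices to find a uniform algebra with square roots and a character that is not a
  point evaluation on some closed subset \<open>X\<close> of the Cantor set, and to take all continuous functions on
  the whole space whose restriction to \<open>X\<close> lies in it.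

  Start with a totally disconnected planar compact set \<open>E\<close> of positive area. Cauchy transforms of bounded
  densities on \<open>E\<close> are continuous on the plane and holomorphic off \<open>E\<close>, so by the maximum principle evaluation
  at a point outside \<open>E\<close> is a character of the algebra that they generate on \<open>E\<close>. Square roots are then adjoined
  freely as in Cole's construction: \<open>X\<close> is the space of all evaluations of formal terms in the
  transforms, rational constants, sums, products and roots. It is compact and metrizable, and since
  a root has only two possible values it is totally disconnected, hence embeds in the Cantor set.
  The character extends to the terms because averaging over the two signs of a root does not
  increase the norm.
\<close>

section \<open>Cauchy transforms\<close>

text \<open>Two demands on \<open>E\<close> pull against each other. Total disconnectedness of
  \<open>X\<close> is inherited from \<open>E\<close>. But on a totally disconnected compact set in
  the plane the polynomials are uniformly dense in the continuous functions (Lavrentiev), so a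
  uniform algebra that contains the coordinate function has no characters beyond the points of
  \<open>E\<close>. The functions used must therefore be holomorphic off \<open>E\<close> up to and
  including infinity. Nonconstant ones that stay continuous on the whole plane exist once
  \<open>E\<close> has positive area, because integration over area tames the singularity of the
  kernel.

  Terms are formal so that all roots are adjoined at once, without a tower of extensions. Countably
  many of them suffice, since constancy on a disc passes to uniform limits. Each root then has two
  admissible values, and the points of \<open>X\<close> record all choices; that \<open>p\<close> is
  dominated by the supremum over \<open>X\<close> is the one analytic fact that has to survive the
  adjunction.\<close>

definition cauchy_transform :: "complex set \<Rightarrow> (complex \<Rightarrow> complex) \<Rightarrow> complex \<Rightarrow> complex" where
  "cauchy_transform E \<rho> z = (\<integral>w. indicator E w *\<^sub>R (\<rho> w / (w - z)) \<partial>lborel)"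

lemma norm_lebesgue_integral_le:
  fixes f :: "'a \<Rightarrow> 'b::{banach, second_countable_topology}"
  assumes "integrable M f" "integrable M g" "\<And>x. x \<in> space M \<Longrightarrow> norm (f x) \<le> g x"
  shows "norm (integral\<^sup>L M f) \<le> integral\<^sup>L M g"
  by (rule order.trans[OF integral_norm_bound integral_mono]) (use assms in auto)

lemma emeasure_cball_le:
  fixes z :: complex
  assumes "r \<ge> 0"
  shows "emeasure lborel (cball z r) \<le> ennreal (4 * r\<^sup>2)"
proof -
  have "cball z r \<subseteq> cbox (z - Complex r r) (z + Complex r r)"
  proof
    fix w assume "w \<in> cball z r"
    then have "norm (z - w) \<le> r" by (simp add: dist_norm)
    then have "\<bar>Re (z - w)\<bar> \<le> r" "\<bar>Im (z - w)\<bar> \<le> r"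
      using abs_Re_le_cmod[of "z - w"] abs_Im_le_cmod[of "z - w"] by linarith+
    then show "w \<in> cbox (z - Complex r r) (z + Complex r r)"
      by (simp add: in_cbox_complex_iff abs_le_iff)
  qed
  then have "emeasure lborel (cball z r) \<le> emeasure lborel (cbox (z - Complex r r) (z + Complex r r))"
    by (intro emeasure_mono) auto
  also have "\<dots> = ennreal (4 * r\<^sup>2)"
    using assms
    by (subst emeasure_lborel_cbox) (auto simp: Basis_complex_def power2_eq_square)
  finally show ?thesis .
qed

text \<open>The dyadic shells around the singularity have area of order \<open>4\<^sup>-\<^sup>k\<close>, which beats the growth
  \<open>2\<^sup>k\<close> of the kernel.\<close>

lemma nn_integral_cauchy_kernel:
  fixes z :: complex
  assumes "\<delta> > 0"
  shows "(\<integral>\<^sup>+w. ennreal (indicator (ball z \<delta>) w / norm (w - z)) \<partial>lborel) \<le> ennreal (16 * \<delta>)"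
proof -
  have pt: "ennreal (indicator (ball z \<delta>) w / norm (w - z))
      \<le> (\<Sum>k. ennreal (2 ^ Suc k / \<delta>) * indicator (cball z (\<delta> / 2 ^ k)) w)" for w
  \<comment> \<open>Elsewhere the left side is 0: off the ball by the indicator, at
    \<open>w = z\<close> because a quotient by zero is 0.\<close>
  proof (cases "w \<in> ball z \<delta> \<and> w \<noteq> z")
    case True
    define u where "u = norm (w - z)"
    have u: "0 < u" "u < \<delta>" using True by (auto simp: u_def dist_norm norm_minus_commute)
    have "\<exists>n. \<delta> / 2 ^ n < u"
    proof -
      obtain n where "(1/2::real) ^ n < u / \<delta>"
        using real_arch_pow_inv[of "u/\<delta>" "1/2"] u assms by auto
      then have "\<delta> / 2 ^ n < u" using assms by (simp add: field_simps)
      then show ?thesis ..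
    qed
    \<comment> \<open>With \<open>n = Suc k\<close> minimal, \<open>u\<close> lies in the shell
      between \<open>\<delta> / 2 ^ Suc k\<close> and \<open>\<delta> / 2 ^ k\<close>, where the
      kernel is at most \<open>2 ^ Suc k / \<delta>\<close>; the case \<open>n = 0\<close> is
      excluded by \<open>u < \<delta>\<close>.\<close>
    define n where "n = (LEAST n. \<delta> / 2 ^ n < u)"
    have n: "\<delta> / 2 ^ n < u" unfolding n_def by (rule LeastI_ex) fact
    then have "n \<noteq> 0" using u by (intro notI) auto
    then obtain k where k: "n = Suc k" by (cases n) auto
    have "\<not> \<delta> / 2 ^ k < u" using not_less_Least[of k "\<lambda>n. \<delta> / 2 ^ n < u"] k by (simp add: n_def)
    then have kb: "u \<le> \<delta> / 2 ^ k" by simp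
    have "1 / u \<le> 2 ^ Suc k / \<delta>" using n k u assms by (simp add: field_simps)
    then have "ennreal (indicator (ball z \<delta>) w / norm (w - z)) \<le> ennreal (2 ^ Suc k / \<delta>)"
      using True by (intro ennreal_leI) (simp add: u_def)
    also have "\<dots> = ennreal (2 ^ Suc k / \<delta>) * indicator (cball z (\<delta> / 2 ^ k)) w"
      using kb by (simp add: u_def dist_norm norm_minus_commute)
    also have "\<dots> \<le> (\<Sum>k. ennreal (2 ^ Suc k / \<delta>) * indicator (cball z (\<delta> / 2 ^ k)) w)"
      using sum_le_suminf[of "\<lambda>k. ennreal (2 ^ Suc k / \<delta>) * indicator (cball z (\<delta> / 2 ^ k)) w" "{k}"]
      by (simp del: sum_mult_indicator)
    finally show ?thesis .
  qed auto
  have "(\<integral>\<^sup>+w. ennreal (indicator (ball z \<delta>) w / norm (w - z)) \<partial>lborel)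
      \<le> (\<integral>\<^sup>+w. (\<Sum>k. ennreal (2 ^ Suc k / \<delta>) * indicator (cball z (\<delta> / 2 ^ k)) w) \<partial>lborel)"
    by (intro nn_integral_mono pt)
  also have "\<dots> = (\<Sum>k. \<integral>\<^sup>+w. ennreal (2 ^ Suc k / \<delta>) * indicator (cball z (\<delta> / 2 ^ k)) w \<partial>lborel)"
    by (intro nn_integral_suminf borel_measurable_times_ennreal borel_measurable_indicator) auto
  also have "\<dots> = (\<Sum>k. ennreal (2 ^ Suc k / \<delta>) * emeasure lborel (cball z (\<delta> / 2 ^ k)))"
    by (subst nn_integral_cmult_indicator) auto
  also have "\<dots> \<le> (\<Sum>k. ennreal (2 ^ Suc k / \<delta>) * ennreal (4 * (\<delta> / 2 ^ k)\<^sup>2))"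
    using assms by (intro suminf_le mult_left_mono emeasure_cball_le) auto
  \<comment> \<open>\<open>2 ^ Suc k / \<delta>\<close> times
    \<open>4 * \<delta>\<^sup>2 / 4 ^ k\<close> is \<open>8 * \<delta> / 2 ^ k\<close>, the term of
    a geometric series with sum \<open>16 * \<delta>\<close>.\<close>
  also have "\<dots> = (\<Sum>k. ennreal (8 * \<delta> * (1/2) ^ k))"
  proof -
    have "ennreal (2 ^ Suc k / \<delta>) * ennreal (4 * (\<delta> / 2 ^ k)\<^sup>2) = ennreal (8 * \<delta> * (1/2) ^ k)" for k
      using assms by (subst ennreal_mult[symmetric])
        (auto simp: power2_eq_square field_simps)
    then show ?thesis by simp
  qed
  also have "\<dots> = ennreal (\<Sum>k. 8 * \<delta> * (1/2) ^ k)"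
    using assms by (intro suminf_ennreal2) (auto intro!: summable_mult summable_geometric)
  also have "(\<Sum>k. 8 * \<delta> * (1/2) ^ k) = 16 * \<delta>"
    by (subst suminf_mult) (auto simp: suminf_geometric)
  finally show ?thesis .
qed

locale bounded_density =
  fixes E :: "complex set" and \<rho> :: "complex \<Rightarrow> complex" and B :: real
  assumes E_meas [measurable]: "E \<in> sets borel" and E_bdd: "bounded E"
    and rho_meas [measurable]: "\<rho> \<in> borel_measurable borel"
    and rho_bdd: "\<And>w. w \<in> E \<Longrightarrow> norm (\<rho> w) \<le> B" and B_pos: "B > 0"
begin

lemma integrable_indicator_E: "integrable lborel (indicat_real E)"
  using emeasure_bounded_finite[OF E_bdd] by (intro integrable_real_indicator) auto

lemma integrable_cauchy:
  "integrable lborel (\<lambda>w. indicator E w *\<^sub>R (\<rho> w / (w - z)))"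
proof (rule Bochner_Integration.integrable_bound)
  have "integrable lborel (\<lambda>w. indicator (ball z 1) w / norm (w - z))"
  proof (rule integrableI_nonneg)
    show "(\<integral>\<^sup>+w. ennreal (indicator (ball z 1) w / norm (w - z)) \<partial>lborel) < \<infinity>"
      using nn_integral_cauchy_kernel[of 1 z] by (auto intro: le_less_trans)
  qed (measurable, auto)
  then show "integrable lborel (\<lambda>w. B * (indicator (ball z 1) w / norm (w - z) + indicator E w))"
    using integrable_indicator_E by auto
  show "AE w in lborel. norm (indicator E w *\<^sub>R (\<rho> w / (w - z)))
      \<le> norm (B * (indicator (ball z 1) w / norm (w - z) + indicator E w))"
  proof (rule AE_I2)
    fix w
    show "norm (indicator E w *\<^sub>R (\<rho> w / (w - z)))
      \<le> norm (B * (indicator (ball z 1) w / norm (w - z) + indicator E w))"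
    proof (cases "w \<in> E")
      case True
      have "1 / norm (w - z) \<le> indicator (ball z 1) w / norm (w - z) + 1"
        by (cases "w \<in> ball z 1") (auto simp: dist_norm norm_minus_commute divide_le_eq)
      then have "norm (\<rho> w) * (1 / norm (w - z)) \<le> B * (indicator (ball z 1) w / norm (w - z) + 1)"
        using rho_bdd[OF True] B_pos by (intro mult_mono) auto
      then show ?thesis using True B_pos by (simp add: norm_divide)
    qed auto
  qed
qed auto

text \<open>The kernel \<open>1 / u\<close> is replaced by the bounded continuous kernel
  \<open>k d u\<close>, which differs from it only for \<open>norm u < d\<close>, and there by at
  most \<open>1 / norm u\<close>. The resulting error is at most \<open>B * (16 * d)\<close>
  uniformly in \<open>z\<close>, so the transform is a uniform limit of continuous
  functions.\<close>

lemma continuous_cauchy_transform: "continuous_on UNIV (cauchy_transform E \<rho>)"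
proof -
  define k :: "real \<Rightarrow> complex \<Rightarrow> complex" where
    "k d u = cnj u / of_real (max ((norm u)\<^sup>2) (d\<^sup>2))" for d u
  define f where "f d z = (\<integral>w. indicator E w *\<^sub>R (\<rho> w * k d (w - z)) \<partial>lborel)" for d z
  have kcont: "continuous_on UNIV (k d)" if "d > 0" for d
  proof -
    have "max ((norm u)\<^sup>2) (d\<^sup>2) \<noteq> 0" for u :: complex
      using that by (metis less_max_iff_disj less_irrefl zero_less_power)
    then show ?thesis unfolding k_def by (intro continuous_intros) auto
  qed
  have kbound: "norm (k d u) \<le> 1 / d" if "d > 0" for d u
  proof -
    have "norm u * d \<le> max ((norm u)\<^sup>2) (d\<^sup>2)"
    proof (cases "norm u \<le> d")
      case True
      then have "norm u * d \<le> d\<^sup>2" using that by (simp add: power2_eq_square)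
      then show ?thesis by simp
    next
      case False
      then have "norm u * d \<le> (norm u)\<^sup>2" by (simp add: power2_eq_square mult_left_mono)
      then show ?thesis by simp
    qed
    moreover have "max ((norm u)\<^sup>2) (d\<^sup>2) > 0" using that by (simp add: less_max_iff_disj)
    ultimately show ?thesis using that
      by (simp add: k_def norm_divide divide_simps mult.commute)
  qed
  have kdiff: "norm (1 / u - k d u) \<le> indicator (ball 0 d) u / norm u" if "d > 0" for d u
  proof (cases "norm u < d")
    case True
    have mx: "max ((norm u)\<^sup>2) (d\<^sup>2) = d\<^sup>2" using True by (simp add: power_mono max_def)
    show ?thesis
    proof (cases "u = 0")
      case False
      have "1 / u - k d u = of_real (1 - (norm u)\<^sup>2 / d\<^sup>2) / u"
        unfolding k_def mx using False that
        by (simp add: field_simps complex_norm_square del: of_real_power)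
      moreover have "\<bar>1 - (norm u)\<^sup>2 / d\<^sup>2\<bar> \<le> 1"
      proof -
        have "(norm u)\<^sup>2 / d\<^sup>2 \<le> 1" using True that by (simp add: power_mono divide_le_eq)
        then show ?thesis by (simp add: abs_le_iff)
      qed
      ultimately have "norm (1 / u - k d u) \<le> 1 / norm u"
        by (simp only: norm_divide norm_of_real) (rule divide_right_mono, auto)
      then show ?thesis using True by simp
    qed (use that in \<open>simp add: k_def\<close>)
  next
    case False
    then have mx: "max ((norm u)\<^sup>2) (d\<^sup>2) = (norm u)\<^sup>2" using that by (simp add: power_mono max_def)
    have "u \<noteq> 0" using False that by auto
    then have "k d u = 1 / u" unfolding k_def mx
      by (simp add: field_simps complex_norm_square del: of_real_power)
    then show ?thesis by simp
  qed
  have kmeas [measurable]: "k d \<in> borel_measurable borel" if "d > 0" for d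
    using kcont[OF that] by (rule borel_measurable_continuous_onI)
  have domin: "norm (indicator E w *\<^sub>R (\<rho> w * k d (w - z))) \<le> B / d * indicator E w"
    if "d > 0" for d w z
    using rho_bdd[of w] kbound[OF that, of "w - z"] B_pos that
    by (auto simp: indicator_def norm_mult intro!: order.trans[OF mult_mono[of "norm (\<rho> w)" B _ "1/d"]])
  have dint: "integrable lborel (\<lambda>w. B / d * indicat_real E w)" for d
    using integrable_indicator_E by auto
  have fmeas: "(\<lambda>w. indicator E w *\<^sub>R (\<rho> w * k d (w - z))) \<in> borel_measurable lborel" if "d > 0" for d z
    using kmeas[OF that] by measurable
  have fint: "integrable lborel (\<lambda>w. indicator E w *\<^sub>R (\<rho> w * k d (w - z)))" if "d > 0" for d z
    using domin[OF that] fmeas[OF that] B_pos that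
    by (intro Bochner_Integration.integrable_bound[OF dint[of d]] AE_I2) auto
  have fcont: "continuous_on UNIV (f d)" if "d > 0" for d
    unfolding continuous_on_sequentially
  proof (intro ballI allI impI)
    fix z :: complex and s assume "(\<forall>n. s n \<in> UNIV) \<and> s \<longlonglongrightarrow> z"
    then have s: "s \<longlonglongrightarrow> z" by simp
    have "(\<lambda>n. f d (s n)) \<longlonglongrightarrow> f d z"
      unfolding f_def
    proof (rule integral_dominated_convergence[where w = "\<lambda>w. B / d * indicat_real E w"])
      show "AE w in lborel. (\<lambda>n. indicator E w *\<^sub>R (\<rho> w * k d (w - s n)))
              \<longlonglongrightarrow> indicator E w *\<^sub>R (\<rho> w * k d (w - z))"
      proof (rule AE_I2)
        fix w
        have "isCont (k d) (w - z)" using kcont[OF that] by (simp add: continuous_on_eq_continuous_at)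
        moreover have "(\<lambda>n. w - s n) \<longlonglongrightarrow> w - z" using s by (intro tendsto_intros)
        ultimately have "(\<lambda>n. k d (w - s n)) \<longlonglongrightarrow> k d (w - z)" by (rule isCont_tendsto_compose)
        then show "(\<lambda>n. indicator E w *\<^sub>R (\<rho> w * k d (w - s n)))
              \<longlonglongrightarrow> indicator E w *\<^sub>R (\<rho> w * k d (w - z))" by (intro tendsto_intros)
      qed
    qed (use fmeas[OF that] dint domin[OF that] in auto)
    then show "(f d \<circ> s) \<longlonglongrightarrow> f d z" by (simp add: o_def)
  qed
  have close: "norm (f d z - cauchy_transform E \<rho> z) \<le> B * (16 * d)" if "d > 0" for d z
  proof -
    have kint: "integrable lborel (\<lambda>w. indicator (ball z d) w / norm (w - z))"
      and kval: "(\<integral>w. indicator (ball z d) w / norm (w - z) \<partial>lborel) \<le> 16 * d"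
    proof -
      show "integrable lborel (\<lambda>w. indicator (ball z d) w / norm (w - z))"
      proof (rule integrableI_nonneg)
        show "(\<integral>\<^sup>+w. ennreal (indicator (ball z d) w / norm (w - z)) \<partial>lborel) < \<infinity>"
          using nn_integral_cauchy_kernel[of d z] that by (auto intro: le_less_trans)
      qed (measurable, auto)
      show "(\<integral>w. indicator (ball z d) w / norm (w - z) \<partial>lborel) \<le> 16 * d"
        using nn_integral_cauchy_kernel[of d z] that
        by (intro integral_real_bounded) auto
    qed
    have "norm (f d z - cauchy_transform E \<rho> z) =
       norm (\<integral>w. indicator E w *\<^sub>R (\<rho> w * k d (w - z)) - indicator E w *\<^sub>R (\<rho> w / (w - z)) \<partial>lborel)"
      unfolding f_def cauchy_transform_def
      by (subst Bochner_Integration.integral_diff) (auto intro: fint that integrable_cauchy)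
    also have "\<dots> \<le> (\<integral>w. B * (indicator (ball z d) w / norm (w - z)) \<partial>lborel)"
    proof (rule norm_lebesgue_integral_le)
      fix w
      show "norm (indicator E w *\<^sub>R (\<rho> w * k d (w - z)) - indicator E w *\<^sub>R (\<rho> w / (w - z)))
          \<le> B * (indicator (ball z d) w / norm (w - z))"
      proof (cases "w \<in> E")
        case True
        have "norm (\<rho> w * k d (w - z) - \<rho> w / (w - z)) = norm (\<rho> w) * norm (1 / (w - z) - k d (w - z))"
          by (subst norm_mult[symmetric]) (simp add: algebra_simps norm_minus_commute)
        also have "\<dots> \<le> B * (indicator (ball 0 d) (w - z) / norm (w - z))"
          using rho_bdd[OF True] kdiff[OF that] B_pos by (intro mult_mono) auto
        also have "indicator (ball 0 d) (w - z) = (indicator (ball z d) w :: real)"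
          by (auto simp: indicator_def dist_norm norm_minus_commute)
        finally show ?thesis using True by simp
      qed (use B_pos in auto)
    qed (intro Bochner_Integration.integrable_diff fint[OF that] integrable_cauchy
        integrable_mult_right kint)+
    also have "\<dots> = B * (\<integral>w. indicator (ball z d) w / norm (w - z) \<partial>lborel)"
      by (rule integral_mult_right_zero)
    also have "\<dots> \<le> B * (16 * d)" using kval B_pos by (intro mult_left_mono) auto
    finally show ?thesis .
  qed
  have "uniform_limit UNIV (\<lambda>n. f (1 / Suc n)) (cauchy_transform E \<rho>) sequentially"
  proof (rule uniform_limitI)
    fix e :: real assume "e > 0"
    have "(\<lambda>n. B * (16 * (1 / real (Suc n)))) \<longlonglongrightarrow> B * (16 * 0)"
      by (intro tendsto_intros LIMSEQ_Suc[OF lim_1_over_n, unfolded of_nat_Suc[symmetric]])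
    then have "\<forall>\<^sub>F n in sequentially. B * (16 * (1 / real (Suc n))) < e"
      using \<open>e > 0\<close> by (intro order_tendstoD(2)) auto
    then show "\<forall>\<^sub>F n in sequentially. \<forall>x\<in>UNIV. dist (f (1 / Suc n) x) (cauchy_transform E \<rho> x) < e"
    proof eventually_elim
      case (elim n)
      show ?case unfolding dist_norm
        using elim close[of "1 / real (Suc n)"] by (auto intro: le_less_trans)
    qed
  qed
  then show ?thesis
    by (rule uniform_limit_theorem[rotated]) (auto intro!: always_eventually fcont)
qed

lemma cauchy_transform_at_infinity: "(cauchy_transform E \<rho> \<longlongrightarrow> 0) at_infinity"
proof -
  obtain R where R: "\<And>w. w \<in> E \<Longrightarrow> norm w \<le> R" using E_bdd bounded_iff by blast
  have "\<forall>\<^sub>F z in at_infinity. norm (cauchy_transform E \<rho> z) \<le> B / (norm z - R) * measure lborel E"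
    unfolding eventually_at_infinity
  proof (intro exI[of _ "R + 1"] allI impI)
    fix z :: complex assume z: "R + 1 \<le> norm z"
    have "norm (cauchy_transform E \<rho> z) \<le> (\<integral>w. B / (norm z - R) * indicator E w \<partial>lborel)"
      unfolding cauchy_transform_def
    proof (rule norm_lebesgue_integral_le)
      fix w
      show "norm (indicator E w *\<^sub>R (\<rho> w / (w - z))) \<le> B / (norm z - R) * indicator E w"
      proof (cases "w \<in> E")
        case True
        have "norm z - R \<le> norm (w - z)"
          using R[OF True] norm_triangle_ineq2[of z w] by (simp add: norm_minus_commute)
        then have "norm (\<rho> w) / norm (w - z) \<le> B / (norm z - R)"
          using rho_bdd[OF True] z B_pos by (intro frac_le) auto
        then show ?thesis using True by (simp add: norm_divide)
      qed auto
    qed (use integrable_cauchy integrable_indicator_E in auto)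
    then show "norm (cauchy_transform E \<rho> z) \<le> B / (norm z - R) * measure lborel E" by simp
  qed
  moreover have "((\<lambda>z::complex. B / (norm z - R) * measure lborel E) \<longlongrightarrow> 0) at_infinity"
  proof -
    have "filterlim (\<lambda>z::complex. norm z - R) at_top at_infinity"
      using filterlim_tendsto_add_at_top[OF tendsto_const[of "-R"] filterlim_norm_at_top]
      by (simp add: add.commute)
    then have "((\<lambda>z::complex. B / (norm z - R)) \<longlongrightarrow> 0) at_infinity"
      by (intro real_tendsto_divide_at_top[OF tendsto_const])
    then show ?thesis by (rule tendsto_mult_left_zero)
  qed
  ultimately show ?thesis by (rule Lim_null_comparison)
qed

text \<open>Partial fractions for \<open>1 / (w - z) - 1 / (w - a)\<close>: the difference quotient
  at a point \<open>a\<close> off \<open>E\<close> is again a Cauchy transform, with density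
  \<open>\<rho> w / (w - a)\<close>. This yields both holomorphy off \<open>E\<close> and the
  separation of points.\<close>

lemma cauchy_transform_diff:
  assumes "a \<notin> E"
  shows "cauchy_transform E \<rho> z - cauchy_transform E \<rho> a =
    (z - a) * cauchy_transform E (\<lambda>w. \<rho> w / (w - a)) z"
proof -
  have "cauchy_transform E \<rho> z - cauchy_transform E \<rho> a =
     (\<integral>w. indicator E w *\<^sub>R (\<rho> w / (w - z)) - indicator E w *\<^sub>R (\<rho> w / (w - a)) \<partial>lborel)"
    unfolding cauchy_transform_def
    by (subst Bochner_Integration.integral_diff) (auto intro: integrable_cauchy)
  also have "\<dots> = (\<integral>w. (z - a) * (indicator E w *\<^sub>R (\<rho> w / (w - a) / (w - z))) \<partial>lborel)"
  proof (rule integral_cong_AE)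
    \<comment> \<open>At \<open>w = z\<close> the two integrands may differ, because quotients by
      \<open>w - z\<close> are read as 0 there; a single point is null.\<close>
    have "AE w in lborel. w \<noteq> z" by (rule AE_lborel_singleton)
    then show "AE w in lborel. indicator E w *\<^sub>R (\<rho> w / (w - z)) - indicator E w *\<^sub>R (\<rho> w / (w - a))
      = (z - a) * (indicator E w *\<^sub>R (\<rho> w / (w - a) / (w - z)))"
    proof eventually_elim
      case (elim w)
      then show ?case using assms by (cases "w \<in> E") (auto simp: divide_simps, auto simp: algebra_simps)
    qed
  qed auto
  also have "\<dots> = (z - a) * cauchy_transform E (\<lambda>w. \<rho> w / (w - a)) z"
    unfolding cauchy_transform_def by (rule integral_mult_right_zero)
  finally show ?thesis .
qed

end

text \<open>\<open>E\<close> keeps a positive distance \<open>d\<close> from \<open>a\<close>, so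
  the density of the difference quotient is bounded by \<open>B / d\<close> and its transform is
  continuous. Caratheodory's criterion then gives the derivative without differentiation under the
  integral.\<close>

lemma holomorphic_cauchy_transform:
  assumes "bounded_density E \<rho> B" and "closed E"
  shows "cauchy_transform E \<rho> holomorphic_on - E"
proof -
  interpret bounded_density E \<rho> B by fact
  have "(cauchy_transform E \<rho> has_field_derivative cauchy_transform E (\<lambda>w. \<rho> w / (w - a)) a) (at a)"
    if a: "a \<notin> E" for a
  proof -
    obtain d where d: "d > 0" "\<And>w. w \<in> E \<Longrightarrow> d \<le> dist a w"
      using separate_point_closed[OF assms(2) a] by blast
    have "bounded_density E (\<lambda>w. \<rho> w / (w - a)) (B / d)"
    proof
      fix w assume w: "w \<in> E"
      show "norm (\<rho> w / (w - a)) \<le> B / d"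
        unfolding norm_divide using rho_bdd[OF w] d(1) d(2)[OF w] B_pos
        by (intro frac_le) (auto simp: dist_norm norm_minus_commute)
    qed (use E_meas E_bdd B_pos d in auto)
    then have "continuous_on UNIV (cauchy_transform E (\<lambda>w. \<rho> w / (w - a)))"
      by (rule bounded_density.continuous_cauchy_transform)
    then have "isCont (cauchy_transform E (\<lambda>w. \<rho> w / (w - a))) a"
      by (simp add: continuous_on_eq_continuous_at)
    then show ?thesis unfolding CARAT_DERIV using cauchy_transform_diff[OF a]
      by (metis mult.commute)
  qed
  then show ?thesis using assms(2)
    by (auto simp: holomorphic_on_open open_Compl)
qed

section \<open>Totally disconnected planar sets of positive area\<close>

definition totally_disconnected :: "'a::topological_space set \<Rightarrow> bool" where
  "totally_disconnected E \<longleftrightarrow> (\<forall>S. connected S \<and> S \<subseteq> E \<longrightarrow> (\<forall>x\<in>S. \<forall>y\<in>S. x = y))"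

lemma totally_disconnectedD:
  "totally_disconnected E \<Longrightarrow> connected S \<Longrightarrow> S \<subseteq> E \<Longrightarrow> x \<in> S \<Longrightarrow> y \<in> S \<Longrightarrow> x = y"
  unfolding totally_disconnected_def by blast

text \<open>Strips around the rational lines are removed from the unit square; their total area is
  at most one half.\<close>

lemma totally_disconnected_positive_area:
  obtains E :: "complex set"
  where "compact E" "E \<subseteq> {z. 0 \<le> Re z \<and> Re z \<le> 1 \<and> 0 \<le> Im z \<and> Im z \<le> 1}" "measure lborel E > 0"
    and "totally_disconnected E"
proof -
  define q where "q = (\<lambda>n. real_of_rat (from_nat_into UNIV n))"
  have q: "\<exists>n. q n = r" if "r \<in> \<rat>" for r
  proof -
    from that obtain s where "r = real_of_rat s" by (auto elim: Rats_cases)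
    moreover obtain n where "from_nat_into UNIV n = s"
      using from_nat_into_surj[of "UNIV :: rat set" s] by auto
    ultimately show ?thesis by (auto simp: q_def)
  qed
  \<comment> \<open>Each index removes a vertical and a horizontal strip of width
    \<open>2 * e n\<close>, hence area at most \<open>4 * e n\<close> from the square; the exponent
    \<open>n + 4\<close> makes these bounds sum to \<open>1/2\<close>.\<close>
  define e where "e n = (1/2 :: real) ^ (n + 4)" for n :: nat
  have e: "e n > 0" for n by (simp add: e_def)
  define Q where "Q = cbox 0 (Complex 1 1)"
  define V where "V n = {z. \<bar>Re z - q n\<bar> < e n}" for n
  define H where "H n = {z. \<bar>Im z - q n\<bar> < e n}" for n
  define E where "E = Q - (\<Union>n. V n \<union> H n)"
  have Qiff: "z \<in> Q \<longleftrightarrow> 0 \<le> Re z \<and> Re z \<le> 1 \<and> 0 \<le> Im z \<and> Im z \<le> 1" for z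
    by (auto simp: Q_def in_cbox_complex_iff)
  have opn: "open (V n)" "open (H n)" for n
    unfolding V_def H_def by (intro open_Collect_less continuous_intros)+
  have cE: "compact E"
    unfolding E_def Q_def by (intro compact_diff compact_cbox open_UN ballI open_Un opn)
  have vol: "emeasure lborel (cbox a b) = ennreal ((Re b - Re a) * (Im b - Im a))"
    if "Re a \<le> Re b" "Im a \<le> Im b" for a b
    using that by (subst emeasure_lborel_cbox) (auto simp: Basis_complex_def)
  have sV: "emeasure lborel (Q \<inter> V n) \<le> ennreal (2 * e n)" for n
  proof -
    have "Q \<inter> V n \<subseteq> cbox (Complex (q n - e n) 0) (Complex (q n + e n) 1)"
      by (auto simp: Qiff V_def in_cbox_complex_iff abs_less_iff)
    then have "emeasure lborel (Q \<inter> V n) \<le> emeasure lborel (cbox (Complex (q n - e n) 0) (Complex (q n + e n) 1))"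
      by (intro emeasure_mono) auto
    then show ?thesis using e[of n] by (subst (asm) vol) auto
  qed
  have sH: "emeasure lborel (Q \<inter> H n) \<le> ennreal (2 * e n)" for n
  proof -
    have "Q \<inter> H n \<subseteq> cbox (Complex 0 (q n - e n)) (Complex 1 (q n + e n))"
      by (auto simp: Qiff H_def in_cbox_complex_iff abs_less_iff)
    then have "emeasure lborel (Q \<inter> H n) \<le> emeasure lborel (cbox (Complex 0 (q n - e n)) (Complex 1 (q n + e n)))"
      by (intro emeasure_mono) auto
    then show ?thesis using e[of n] by (subst (asm) vol) auto
  qed
  have meas [measurable]: "V n \<in> sets borel" "H n \<in> sets borel" "Q \<in> sets borel" "E \<in> sets borel" for n
    using opn[of n] cE by (auto simp: Q_def borel_compact)
  have "(1::ennreal) = emeasure lborel Q"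
    unfolding Q_def by (subst vol) auto
  also have "\<dots> \<le> emeasure lborel (E \<union> (\<Union>n. (Q \<inter> V n) \<union> (Q \<inter> H n)))"
    by (intro emeasure_mono) (auto simp: E_def)
  also have "\<dots> \<le> emeasure lborel E + emeasure lborel (\<Union>n. (Q \<inter> V n) \<union> (Q \<inter> H n))"
    by (intro emeasure_subadditive) auto
  also have "emeasure lborel (\<Union>n. (Q \<inter> V n) \<union> (Q \<inter> H n)) \<le> (\<Sum>n. emeasure lborel ((Q \<inter> V n) \<union> (Q \<inter> H n)))"
    by (intro emeasure_subadditive_countably) auto
  also have "\<dots> \<le> (\<Sum>n. ennreal (4 * e n))"
  proof (intro suminf_le allI)
    fix n
    have "emeasure lborel ((Q \<inter> V n) \<union> (Q \<inter> H n)) \<le> emeasure lborel (Q \<inter> V n) + emeasure lborel (Q \<inter> H n)"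
      by (intro emeasure_subadditive) auto
    also have "\<dots> \<le> ennreal (2 * e n) + ennreal (2 * e n)" by (intro add_mono sV sH)
    also have "\<dots> = ennreal (4 * e n)" using e[of n] by (subst ennreal_plus[symmetric]) auto
    finally show "emeasure lborel ((Q \<inter> V n) \<union> (Q \<inter> H n)) \<le> ennreal (4 * e n)" .
  qed auto
  also have "(\<Sum>n. ennreal (4 * e n)) = ennreal (\<Sum>n. 4 * e n)"
    by (intro suminf_ennreal2) (auto simp: e_def power_add intro!: summable_mult summable_mult2 summable_geometric)
  also have "(\<Sum>n. 4 * e n) = 1/2"
  proof -
    have "4 * e n = 1/4 * (1/2) ^ n" for n by (simp add: e_def power_add power_divide)
    then have "(\<Sum>n. 4 * e n) = (\<Sum>n. 1/4 * (1/2) ^ n)" by (simp only:)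
    also have "\<dots> = 1/4 * (\<Sum>n. (1/2) ^ n)" by (intro suminf_mult summable_geometric) auto
    finally show ?thesis by (simp add: suminf_geometric)
  qed
  finally have main: "1 \<le> emeasure lborel E + ennreal (1/2)"
    by (simp add: add_left_mono)
  have pos: "measure lborel E > 0"
  proof (rule ccontr)
    assume "\<not> measure lborel E > 0"
    then have "measure lborel E = 0" by (simp add: zero_less_measure_iff)
    moreover have "emeasure lborel E = ennreal (measure lborel E)"
      using emeasure_bounded_finite[OF compact_imp_bounded[OF cE]]
      by (intro emeasure_eq_ennreal_measure) auto
    ultimately have "1 \<le> ennreal (1/2)" using main by simp
    then have "ennreal 1 \<le> ennreal (1/2)" by simp
    then show False by (subst (asm) ennreal_le_iff) auto
  qed
  have disc: "x = y" if S: "connected S" "S \<subseteq> E" "x \<in> S" "y \<in> S" for S x y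
  proof -
    \<comment> \<open>\<open>h\<close> stands for either coordinate. It maps a connected set onto an
      interval; with two points this interval would contain a rational \<open>q n\<close>, a value
      excluded on \<open>E\<close>.\<close>
    have one: "h x = h y" if h: "continuous_on UNIV h" "\<And>z n. z \<in> E \<Longrightarrow> h z \<noteq> q n" for h :: "complex \<Rightarrow> real"
    proof (rule ccontr)
      assume "h x \<noteq> h y"
      then have "min (h x) (h y) < max (h x) (h y)" by (auto simp: min_def max_def)
      then obtain r where r: "r \<in> \<rat>" "min (h x) (h y) < r" "r < max (h x) (h y)"
        using Rats_dense_in_real by blast
      have "connected (h ` S)" using S(1) h(1) by (intro connected_continuous_image) (auto intro: continuous_on_subset)
      then have "r \<in> h ` S"
        using r S(3,4) connectedD_interval[of "h ` S" "h x" "h y" r]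
          connectedD_interval[of "h ` S" "h y" "h x" r]
        by (auto simp: min_def max_def split: if_splits)
      then obtain u where "u \<in> E" "h u = r" using S(2) by auto
      moreover obtain n where "q n = r" using q[OF r(1)] ..
      ultimately show False using h(2)[of u n] by simp
    qed
    have avoid: "Re z \<noteq> q n" "Im z \<noteq> q n" if "z \<in> E" for z n
    proof -
      have "z \<notin> V n" "z \<notin> H n" using that by (auto simp: E_def)
      then show "Re z \<noteq> q n" "Im z \<noteq> q n" using e[of n] by (auto simp: V_def H_def)
    qed
    have "Re x = Re y" by (rule one) (auto intro!: continuous_intros simp: avoid)
    moreover have "Im x = Im y" by (rule one) (auto intro!: continuous_intros simp: avoid)
    ultimately show ?thesis by (simp add: complex_eq_iff)
  qed
  have "totally_disconnected E" unfolding totally_disconnected_def using disc by blast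
  then show ?thesis by (intro that[of E]) (use cE pos Qiff in \<open>auto simp: E_def\<close>)
qed

text \<open>Let \<open>g 0\<close> have density 1 and let \<open>g n\<close> have density
  \<open>1 / (w + m)\<close>, where \<open>m = Suc n\<close>. Then
  \<open>g 0 z - g 0 (-m) = (z + m) * g n z\<close> for \<open>n > 0\<close>. If all
  \<open>g n\<close> agree at two distinct points, those with \<open>n > 0\<close> vanish there, so
  \<open>g 0 (-m)\<close> is the same for all these \<open>m\<close>. As \<open>g 0\<close> vanishes
  at infinity, this value is 0; but \<open>g 0\<close> has positive real part at \<open>-m\<close>,
  because \<open>E\<close> lies to the right of it.\<close>

lemma totally_disconnected_with_separating_transforms:
  obtains E :: "complex set" and g :: "nat \<Rightarrow> complex \<Rightarrow> complex" and z0 :: complex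
  where "compact E" "z0 \<notin> E" "E \<noteq> {}"
    "totally_disconnected E"
    "\<forall>n. continuous_on UNIV (g n)" "\<forall>n. g n holomorphic_on - E" "\<forall>n. (g n \<longlongrightarrow> 0) at_infinity"
    "g 0 z0 \<noteq> 0"
    "inj_on (\<lambda>z n. g n z) (insert z0 E)"
proof -
  obtain E :: "complex set"
    where cE: "compact E" and sub: "E \<subseteq> {z. 0 \<le> Re z \<and> Re z \<le> 1 \<and> 0 \<le> Im z \<and> Im z \<le> 1}"
      and pos: "measure lborel E > 0"
      and disc: "totally_disconnected E"
    by (rule totally_disconnected_positive_area)
  \<comment> \<open>For \<open>n > 0\<close> the poles are -2, -3, and so on, at distance more than
    1 from \<open>E\<close>, whence the common bound 1 on the densities; the point -1 serves as
    \<open>z0\<close>.\<close>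
  define g where "g n = cauchy_transform E (if n = 0 then (\<lambda>_. 1) else (\<lambda>w. 1 / (w + of_nat (Suc n))))" for n :: nat
  have dens: "bounded_density E (if n = 0 then (\<lambda>_. 1) else (\<lambda>w. 1 / (w + of_nat (Suc n)))) 1" for n
  proof
    fix w assume w: "w \<in> E"
    have "1 \<le> Re (w + of_nat (Suc n))" using w sub by auto
    also have "\<dots> \<le> norm (w + of_nat (Suc n))" by (rule complex_Re_le_cmod)
    finally show "norm ((if n = 0 then (\<lambda>_. 1) else (\<lambda>w. 1 / (w + of_nat (Suc n)))) w) \<le> 1"
      by (simp add: norm_divide divide_le_eq)
  qed (use cE in \<open>auto simp: borel_compact compact_imp_bounded\<close>)
  interpret one: bounded_density E "\<lambda>_. 1" 1 using dens[of 0] by simp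
  have notin: "- of_nat (Suc n) \<notin> E" for n using sub by auto
  have step: "g 0 z - g 0 (- of_nat (Suc n)) = (z + of_nat (Suc n)) * g n z" if "n > 0" for n z
    using one.cauchy_transform_diff[OF notin, of z n] that by (simp add: g_def del: of_nat_Suc)
  have g0: "Re (g 0 (- of_nat (Suc n))) > 0" for n
  proof -
    define m where "m = real (Suc n)"
    have m: "m \<ge> 1" by (simp add: m_def)
    define f where "f w = indicator E w *\<^sub>R (1 / (w - - of_nat (Suc n)))" for w :: complex
    have fint: "integrable lborel f" unfolding f_def using one.integrable_cauchy[of "- of_nat (Suc n)"] by simp
    \<comment> \<open>A lower bound for \<open>Re (1 / (w + m))\<close> on the unit square: the
      numerator \<open>Re w + m\<close> is at least 1 and the denominator
      \<open>(norm (w + m))\<^sup>2\<close> at most \<open>(m + 1)\<^sup>2 + 1\<close>.\<close>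
    have "(\<integral>w. 1 / ((m + 1)\<^sup>2 + 1) * indicator E w \<partial>lborel) \<le> (\<integral>w. Re (f w) \<partial>lborel)"
    proof (rule integral_mono)
      fix w
      show "1 / ((m + 1)\<^sup>2 + 1) * indicator E w \<le> Re (f w)"
      proof (cases "w \<in> E")
        case True
        then have w: "0 \<le> Re w" "Re w \<le> 1" "0 \<le> Im w" "Im w \<le> 1" using sub by auto
        have "1 / ((m + 1)\<^sup>2 + 1) \<le> (Re w + m) / ((Re w + m)\<^sup>2 + (Im w)\<^sup>2)"
        proof (rule frac_le)
          show "(Re w + m)\<^sup>2 + (Im w)\<^sup>2 \<le> (m + 1)\<^sup>2 + 1"
          proof (rule add_mono)
            show "(Re w + m)\<^sup>2 \<le> (m + 1)\<^sup>2" using w m by (intro power_mono) auto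
            show "(Im w)\<^sup>2 \<le> 1" using w power_mono[of "Im w" 1 2] by simp
          qed
          show "0 < (Re w + m)\<^sup>2 + (Im w)\<^sup>2"
            using w m by (intro add_pos_nonneg) auto
        qed (use w m in auto)
        then show ?thesis using True by (simp add: f_def Re_divide m_def del: of_nat_Suc)
      qed (simp add: f_def)
    qed (use fint one.integrable_indicator_E in auto)
    also have "\<dots> = Re (\<integral>w. f w \<partial>lborel)" using fint by simp
    also have "(\<integral>w. f w \<partial>lborel) = g 0 (- of_nat (Suc n))"
      by (simp add: g_def f_def cauchy_transform_def)
    finally have "1 / ((m + 1)\<^sup>2 + 1) * measure lborel E \<le> Re (g 0 (- of_nat (Suc n)))"
      by simp
    moreover have "1 / ((m + 1)\<^sup>2 + 1) * measure lborel E > 0"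
      using pos by (intro mult_pos_pos divide_pos_pos) (auto intro: add_nonneg_pos)
    ultimately show ?thesis by linarith
  qed
  have lim: "(g n \<longlongrightarrow> 0) at_infinity" for n
    unfolding g_def by (rule bounded_density.cauchy_transform_at_infinity[OF dens])
  show ?thesis
  proof (rule that[of E "-1" g])
    show "inj_on (\<lambda>z n. g n z) (insert (- 1) E)"
    proof (rule inj_onI, rule ccontr)
      fix x y assume "(\<lambda>n. g n x) = (\<lambda>n. g n y)" "x \<noteq> y"
      then have eq: "g n x = g n y" for n by (auto simp: fun_eq_iff)
      have const: "g 0 (- of_nat (Suc n)) = g 0 x" if "n > 0" for n
      proof -
        have "(x + of_nat (Suc n)) * g n x = (y + of_nat (Suc n)) * g n x"
          using step[OF that, of x] step[OF that, of y] eq[of 0] eq[of n] by simp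
        then have "g n x = 0" using \<open>x \<noteq> y\<close> by simp
        then show ?thesis using step[OF that, of x] by simp
      qed
      have "filterlim (\<lambda>n. - of_nat (Suc n) :: complex) at_infinity sequentially"
        using filterlim_compose[OF tendsto_of_nat filterlim_Suc]
        by (simp only: filterlim_at_infinity_conv_norm_at_top norm_minus_cancel)
      then have "(\<lambda>n. g 0 (- of_nat (Suc n))) \<longlonglongrightarrow> 0"
        by (rule filterlim_compose[OF lim])
      moreover have "\<forall>\<^sub>F n in sequentially. g 0 (- of_nat (Suc n)) = g 0 x"
        using eventually_gt_at_top[of 0] by eventually_elim (rule const)
      then have "(\<lambda>n. g 0 (- of_nat (Suc n))) \<longlonglongrightarrow> g 0 x" by (rule tendsto_eventually)
      ultimately have "g 0 x = 0" by (metis LIMSEQ_unique)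
      then show False using g0[of 1] const[of 1] by simp
    qed
  next
    show "\<forall>n. g n holomorphic_on - E"
      unfolding g_def by (intro allI holomorphic_cauchy_transform[OF dens compact_imp_closed[OF cE]])
    show "\<forall>n. continuous_on UNIV (g n)"
      unfolding g_def by (intro allI bounded_density.continuous_cauchy_transform[OF dens])
    show "-1 \<notin> E" using notin[of 0] by simp
    show "g 0 (- 1) \<noteq> 0" using g0[of 0] by auto
    show "E \<noteq> {}" using pos by auto
  qed (use cE disc lim in auto)
qed

text \<open>A function that vanishes at infinity satisfies the maximum principle off \<open>E\<close>. Applied to
  \<open>F\<^sup>n h\<close>, with \<open>h\<close> vanishing at infinity, it bounds \<open>F\<close> wherever \<open>h\<close> is nonzero.\<close>

lemma norm_le_of_vanishing_at_infinity:
  fixes h :: "complex \<Rightarrow> complex"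
  assumes E: "compact E" "z \<notin> E" and h: "continuous_on UNIV h" "h holomorphic_on - E" "(h \<longlongrightarrow> 0) at_infinity"
    and M: "\<And>w. w \<in> E \<Longrightarrow> norm (h w) \<le> M" "M \<ge> 0"
  shows "norm (h z) \<le> M"
proof (rule field_le_epsilon)
  fix e :: real assume e: "e > 0"
  have "\<forall>\<^sub>F w in at_infinity. norm (h w) < e"
    using h(3) e by (auto simp: tendsto_iff dist_norm)
  then obtain R where R: "\<And>w. R \<le> norm w \<Longrightarrow> norm (h w) < e" by (auto simp: eventually_at_infinity)
  define S where "S = ball 0 (max R (norm z + 1)) - E"
  have opS: "open S" unfolding S_def using E by (auto intro: open_Diff compact_imp_closed)
  have fr: "frontier S \<subseteq> E \<union> sphere 0 (max R (norm z + 1))"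
  proof
    fix w assume "w \<in> frontier S"
    then have w: "w \<in> closure S" "w \<notin> S" using opS by (auto simp: frontier_def interior_open)
    have "closure S \<subseteq> cball 0 (max R (norm z + 1))"
      unfolding S_def by (intro closure_minimal) auto
    then show "w \<in> E \<union> sphere 0 (max R (norm z + 1))" using w by (auto simp: S_def)
  qed
  show "norm (h z) \<le> M + e"
  proof (rule maximum_modulus_frontier[of h S])
    show "h holomorphic_on interior S"
      using opS h(2) by (auto simp: interior_open S_def intro: holomorphic_on_subset)
    show "continuous_on (closure S) h" using h(1) continuous_on_subset by blast
    show "bounded S" unfolding S_def by (meson bounded_ball bounded_diff)
    show "norm (h w) \<le> M + e" if "w \<in> frontier S" for w
    proof (cases "w \<in> E")
      case True then show ?thesis using M(1)[of w] e by simp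
    next
      case False
      then have "norm w = max R (norm z + 1)" using fr that by auto
      then have "norm (h w) < e" by (intro R) auto
      then show ?thesis using M(2) by simp
    qed
    show "z \<in> S" using E by (auto simp: S_def)
  qed
qed

text \<open>Constant factors disappear on taking \<open>n\<close>-th roots. The trick serves twice:
  for the auxiliary factor \<open>h\<close> in the maximum principle, and for the factor 2 lost when
  a root is adjoined.\<close>

lemma le_of_power_le_mult:
  fixes a b c :: real
  assumes "\<And>n. a ^ n \<le> c * b ^ n" and "a \<ge> 0" "b \<ge> 0"
  shows "a \<le> b"
proof (rule ccontr)
  assume "\<not> a \<le> b"
  then have ab: "b < a" by simp
  show False
  proof (cases "b = 0")
    case True
    then show False using assms(1)[of 1] ab by simp
  next
    case False
    then have b: "b > 0" using assms by simp
    obtain n where "c < (a / b) ^ n" using real_arch_pow[of "a / b" c] ab b by auto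
    then have "c * b ^ n < a ^ n" using b by (simp add: power_divide field_simps)
    then show False using assms(1)[of n] by simp
  qed
qed

lemma norm_le_of_limit_at_infinity:
  fixes h F :: "complex \<Rightarrow> complex"
  assumes E: "compact E" "z \<notin> E"
    and h: "continuous_on UNIV h" "h holomorphic_on - E" "(h \<longlongrightarrow> 0) at_infinity" "h z \<noteq> 0"
    and F: "continuous_on UNIV F" "F holomorphic_on - E" "(F \<longlongrightarrow> c) at_infinity"
    and M: "\<And>w. w \<in> E \<Longrightarrow> norm (F w) \<le> M" "M \<ge> 0"
  shows "norm (F z) \<le> M"
proof -
  have "bounded (h ` E)"
    using E h(1) by (intro compact_imp_bounded compact_continuous_image) (auto intro: continuous_on_subset)
  then obtain B where B: "B > 0" "\<And>w. w \<in> E \<Longrightarrow> norm (h w) \<le> B" by (auto simp: bounded_pos)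
  have "norm (F z) ^ n \<le> B / norm (h z) * M ^ n" for n
  proof -
    have "norm (F z ^ n * h z) \<le> M ^ n * B"
    proof (rule norm_le_of_vanishing_at_infinity[OF E, where h = "\<lambda>z. F z ^ n * h z"])
      show "((\<lambda>z. F z ^ n * h z) \<longlongrightarrow> 0) at_infinity"
        using tendsto_mult[OF tendsto_power[OF F(3)] h(3)] by simp
      show "norm (F w ^ n * h w) \<le> M ^ n * B" if "w \<in> E" for w
        using M B that by (simp add: norm_mult norm_power mult_mono power_mono)
    qed (use F h M B in \<open>auto intro!: continuous_intros holomorphic_intros\<close>)
    then show ?thesis using h(4) by (simp add: norm_mult norm_power field_simps)
  qed
  then show ?thesis by (rule le_of_power_le_mult) (use M in auto)
qed

section \<open>Adjoining square roots\<close>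

text \<open>Countability shapes this signature: the generators form a sequence and the constants are
  complex rationals, so functions on terms form a second countable product, as the embedding into
  the Cantor set requires. Differences are expressed through \<open>Cst\<close> and
  \<open>Mul\<close>.\<close>

datatype trm = Gen nat | Cst rat rat | Add trm trm | Mul trm trm | Rt trm

instance trm :: countable
  by countable_datatype

definition valuation :: "(trm \<Rightarrow> complex) \<Rightarrow> bool" where
  "valuation v \<longleftrightarrow>
     (\<forall>a b. v (Cst a b) = Complex (of_rat a) (of_rat b)) \<and>
     (\<forall>s t. v (Add s t) = v s + v t) \<and>
     (\<forall>s t. v (Mul s t) = v s * v t) \<and>
     (\<forall>t. (v (Rt t))\<^sup>2 = v t)"

lemma valuation_simps:
  assumes "valuation v"
  shows "v (Cst a b) = Complex (of_rat a) (of_rat b)" "v (Add s t) = v s + v t"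
    "v (Mul s t) = v s * v t" "(v (Rt t))\<^sup>2 = v t"
  using assms by (auto simp: valuation_def)

text \<open>A finite set that contains the radicands of all its members stands for one stage in a
  tower of root extensions: the terms of the stage are those whose radicands lie in the set.\<close>

primrec radicands :: "trm \<Rightarrow> trm set" where
  "radicands (Gen n) = {}"
| "radicands (Cst a b) = {}"
| "radicands (Add s t) = radicands s \<union> radicands t"
| "radicands (Mul s t) = radicands s \<union> radicands t"
| "radicands (Rt t) = insert t (radicands t)"

lemma finite_radicands: "finite (radicands t)"
  by (induction t) auto

lemma size_radicands: "s \<in> radicands t \<Longrightarrow> size s < size t"
  by (induction t) auto

lemma radicands_trans: "s \<in> radicands t \<Longrightarrow> radicands s \<subseteq> radicands t"
  by (induction t) auto

primrec pow :: "trm \<Rightarrow> nat \<Rightarrow> trm" where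
  "pow t 0 = Cst 1 0"
| "pow t (Suc n) = Mul t (pow t n)"

lemma valuation_pow: "valuation v \<Longrightarrow> v (pow t n) = v t ^ n"
  by (induction n) (auto simp: valuation_simps complex_eq_iff)

lemma radicands_pow: "radicands (pow t n) \<subseteq> radicands t"
  by (induction n) auto


text \<open>The square of \<open>Rt s\<close> is \<open>s\<close>, itself a term over
  \<open>S\<close>, so products reduce to degree one in \<open>Rt s\<close>. A root
  \<open>Rt r\<close> with \<open>r\<close> other than \<open>s\<close> needs no splitting, since
  \<open>r\<close> and its radicands lie in \<open>S\<close>.\<close>

lemma split_radicand:
  assumes S: "radicands s \<subseteq> S" "\<And>r. r \<in> S \<Longrightarrow> radicands r \<subseteq> S"
    and "radicands t \<subseteq> insert s S"
  shows "\<exists>a b. radicands a \<subseteq> S \<and> radicands b \<subseteq> S \<and>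
    (\<forall>v. valuation v \<longrightarrow> v t = v a + v b * v (Rt s))"
  using assms(3)
proof (induction t)
  case (Gen n)
  show ?case
    by (intro exI[of _ "Gen n"] exI[of _ "Cst 0 0"]) (auto simp: valuation_simps complex_eq_iff)
next
  case (Cst p q)
  show ?case
    by (intro exI[of _ "Cst p q"] exI[of _ "Cst 0 0"]) (auto simp: valuation_simps complex_eq_iff)
next
  case (Add t1 t2)
  then obtain a1 b1 a2 b2 where
    "radicands a1 \<subseteq> S" "radicands b1 \<subseteq> S" "radicands a2 \<subseteq> S" "radicands b2 \<subseteq> S"
    "\<forall>v. valuation v \<longrightarrow> v t1 = v a1 + v b1 * v (Rt s)" "\<forall>v. valuation v \<longrightarrow> v t2 = v a2 + v b2 * v (Rt s)"
    by auto
  then show ?case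
    by (intro exI[of _ "Add a1 a2"] exI[of _ "Add b1 b2"]) (auto simp: valuation_simps algebra_simps)
next
  case (Mul t1 t2)
  then obtain a1 b1 a2 b2 where *:
    "radicands a1 \<subseteq> S" "radicands b1 \<subseteq> S" "radicands a2 \<subseteq> S" "radicands b2 \<subseteq> S"
    "\<And>v. valuation v \<Longrightarrow> v t1 = v a1 + v b1 * v (Rt s)" "\<And>v. valuation v \<Longrightarrow> v t2 = v a2 + v b2 * v (Rt s)"
    by auto
  have "v (Mul t1 t2) = v (Add (Mul a1 a2) (Mul (Mul b1 b2) s)) + v (Add (Mul a1 b2) (Mul a2 b1)) * v (Rt s)"
    if "valuation v" for v
  proof -
    have "v s = (v (Rt s))\<^sup>2" using valuation_simps(4)[OF that] by simp
    then show ?thesis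
      by (simp add: valuation_simps(1-3)[OF that] *(5,6)[OF that] algebra_simps power2_eq_square)
  qed
  then show ?case
    using * S(1)
    by (intro exI[of _ "Add (Mul a1 a2) (Mul (Mul b1 b2) s)"] exI[of _ "Add (Mul a1 b2) (Mul a2 b1)"]) auto
next
  case (Rt r)
  show ?case
  proof (cases "r = s")
    case True
    then show ?thesis
      by (intro exI[of _ "Cst 0 0"] exI[of _ "Cst 1 0"]) (auto simp: valuation_simps complex_eq_iff)
  next
    case False
    then have "radicands (Rt r) \<subseteq> S" using Rt.prems S(2) by auto
    then show ?thesis
      by (intro exI[of _ "Rt r"] exI[of _ "Cst 0 0"]) (auto simp: valuation_simps complex_eq_iff)
  qed
qed

text \<open>Changing the sign of \<open>Rt s\<close> changes the radicands built from it; their roots are re-chosen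
  arbitrarily, all others are kept.\<close>

primrec conjugate :: "trm \<Rightarrow> (trm \<Rightarrow> complex) \<Rightarrow> trm \<Rightarrow> complex" where
  "conjugate s v (Gen n) = v (Gen n)"
| "conjugate s v (Cst a b) = v (Cst a b)"
| "conjugate s v (Add t u) = conjugate s v t + conjugate s v u"
| "conjugate s v (Mul t u) = conjugate s v t * conjugate s v u"
| "conjugate s v (Rt t) =
     (if t = s then - v (Rt s)
      else if conjugate s v t = v t then v (Rt t) else csqrt (conjugate s v t))"

text \<open>If \<open>Rt s\<close> does not occur, no radicand changes, and the clause that keeps
  the root of an unchanged radicand applies at every \<open>Rt\<close>.\<close>

lemma conjugate_eq: "valuation v \<Longrightarrow> s \<notin> radicands t \<Longrightarrow> conjugate s v t = v t"
  by (induction t) (auto simp: valuation_simps)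

lemma valuation_conjugate:
  assumes "valuation v"
  shows "valuation (conjugate s v)"
proof -
  have "conjugate s v s = v s"
    using assms size_radicands[of s s] by (intro conjugate_eq) auto
  then show ?thesis
    using assms by (auto simp: valuation_def)
qed

primrec principal_value :: "(nat \<Rightarrow> complex) \<Rightarrow> trm \<Rightarrow> complex" where
  "principal_value c (Gen n) = c n"
| "principal_value c (Cst a b) = Complex (of_rat a) (of_rat b)"
| "principal_value c (Add t u) = principal_value c t + principal_value c u"
| "principal_value c (Mul t u) = principal_value c t * principal_value c u"
| "principal_value c (Rt t) = csqrt (principal_value c t)"

lemma valuation_principal_value: "valuation (principal_value c)"
  by (simp add: valuation_def)

text \<open>Cole's extension of \<open>E\<close> with all roots adjoined at once: the fibre over a
  point \<open>z\<close> consists of all admissible choices of roots, and the topology is that of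
  pointwise convergence on terms.\<close>

definition spectrum :: "complex set \<Rightarrow> (nat \<Rightarrow> complex \<Rightarrow> complex) \<Rightarrow> (trm \<Rightarrow> complex) set" where
  "spectrum E g = {v. valuation v \<and> (\<exists>z\<in>E. \<forall>n. v (Gen n) = g n z)}"

lemma conjugate_in_spectrum: "v \<in> spectrum E g \<Longrightarrow> conjugate s v \<in> spectrum E g"
  by (auto simp: spectrum_def valuation_conjugate)

text \<open>Conjugation averages away \<open>Rt s\<close> in \<open>t = a + b Rt s\<close>, so \<open>a\<close> and \<open>b Rt s\<close>, whose square lies one
  level below, are bounded by the norm of \<open>t\<close>. This costs a factor 2, removed by passing to powers.\<close>

lemma norm_le_spectral_norm:
  assumes p: "valuation p"
    and base: "\<And>t M. radicands t = {} \<Longrightarrow> (\<And>v. v \<in> spectrum E g \<Longrightarrow> norm (v t) \<le> M) \<Longrightarrow> norm (p t) \<le> M"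
    and M: "\<And>v. v \<in> spectrum E g \<Longrightarrow> norm (v t) \<le> M"
  shows "norm (p t) \<le> M"
proof -
  have ne: "M \<ge> 0" if "\<And>v. v \<in> spectrum E g \<Longrightarrow> norm (v t) \<le> M" for M t
  proof -
    \<comment> \<open>Over an empty spectrum \<open>base\<close> would apply with the bound
      -1.\<close>
    have "spectrum E g \<noteq> {}"
    proof
      assume "spectrum E g = {}"
      then have "norm (p (Cst 0 0)) \<le> -1" by (intro base) auto
      then show False using norm_ge_zero[of "p (Cst 0 0)"] by linarith
    qed
    then show ?thesis using that norm_ge_zero order_trans by blast
  qed
  \<comment> \<open>The induction runs over finite stages \<open>S\<close> and not over the
    radicands of \<open>t\<close>: the auxiliary terms \<open>a\<close>,
    \<open>Mul (Mul b b) s\<close> and \<open>pow t k\<close> may have other radicands, but these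
    stay within \<open>S\<close>.\<close>
  have "norm (p t) \<le> M"
    if "finite S" "\<And>r. r \<in> S \<Longrightarrow> radicands r \<subseteq> S" "radicands t \<subseteq> S"
       "\<And>v. v \<in> spectrum E g \<Longrightarrow> norm (v t) \<le> M" for S t M
    using that
  proof (induction "card S" arbitrary: S t M)
    case 0
    then show ?case using base by auto
  next
    case (Suc n)
    then have "S \<noteq> {}" by auto
    \<comment> \<open>A member \<open>s\<close> of greatest size is a radicand of no member of
      \<open>S\<close>, so what remains of \<open>S\<close> without \<open>s\<close> is again closed
      under radicands.\<close>
    then have "Max (size ` S) \<in> size ` S" using Suc.prems(1) by (intro Max_in) auto
    then obtain s where "s \<in> S" "size s = Max (size ` S)" by auto
    then have s: "s \<in> S" "\<And>r. r \<in> S \<Longrightarrow> size r \<le> size s"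
      using Suc.prems(1) by auto
    define S' where "S' = S - {s}"
    have S': "finite S'" "n = card S'" "s \<notin> S'" "insert s S' = S" using Suc s by (auto simp: S'_def)
    have closed: "radicands r \<subseteq> S'" if "r \<in> S" for r
      using Suc.prems(2)[OF that] size_radicands[of s r] s(2)[OF that] by (auto simp: S'_def)
    have IH: "norm (p r) \<le> K" if "radicands r \<subseteq> S'" "\<And>v. v \<in> spectrum E g \<Longrightarrow> norm (v r) \<le> K" for r K
      by (rule Suc.hyps(1)[OF S'(2,1)]) (use that closed S' in auto)
    have two: "norm (p t) \<le> 2 * M"
      if t: "radicands t \<subseteq> S" and M: "\<And>v. v \<in> spectrum E g \<Longrightarrow> norm (v t) \<le> M" for t M
    proof -
      have "M \<ge> 0" using ne[OF M] .
      obtain a b where ab: "radicands a \<subseteq> S'" "radicands b \<subseteq> S'"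
        "\<And>v. valuation v \<Longrightarrow> v t = v a + v b * v (Rt s)"
        using split_radicand[of s S' t] closed s S' t by auto
      have bounds: "norm (v a) \<le> M" "norm (v b * v (Rt s)) \<le> M" if v: "v \<in> spectrum E g" for v
      proof -
        have val: "valuation v" using v by (simp add: spectrum_def)
        define w where "w = conjugate s v"
        have "s \<notin> radicands a" "s \<notin> radicands b" using ab(1,2) S'(3) by auto
        then have w: "w \<in> spectrum E g" "valuation w" "w a = v a" "w b = v b" "w (Rt s) = - v (Rt s)"
          using conjugate_in_spectrum[OF v] valuation_conjugate[OF val] conjugate_eq[OF val]
          by (auto simp: w_def)
        have "2 * v a = v t + w t" "2 * (v b * v (Rt s)) = v t - w t"
          using ab(3)[OF val] ab(3)[OF w(2)] w by (auto simp: algebra_simps)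
        then have "norm (2 * v a) \<le> M + M" "norm (2 * (v b * v (Rt s))) \<le> M + M"
          using M[OF v] M[OF w(1)] norm_triangle_ineq[of "v t" "w t"] norm_triangle_ineq4[of "v t" "w t"]
          by (simp_all del: norm_mult)
        then show "norm (v a) \<le> M" "norm (v b * v (Rt s)) \<le> M" by (simp_all add: norm_mult)
      qed
      have sq: "u (Mul (Mul b b) s) = (u b * u (Rt s))\<^sup>2" if "valuation u" for u
        using valuation_simps(3)[OF that] valuation_simps(4)[OF that, of s]
        by (simp add: power_mult_distrib power2_eq_square)
      have pa: "norm (p a) \<le> M" using IH[OF ab(1)] bounds(1) by blast
      have "norm (p (Mul (Mul b b) s)) \<le> M\<^sup>2"
      proof (rule IH)
        show "radicands (Mul (Mul b b) s) \<subseteq> S'" using ab closed[OF s(1)] by auto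
        show "norm (v (Mul (Mul b b) s)) \<le> M\<^sup>2" if "v \<in> spectrum E g" for v
          using that bounds(2)[OF that] sq[of v] by (simp add: spectrum_def norm_power power_mono)
      qed
      then have "(norm (p b * p (Rt s)))\<^sup>2 \<le> M\<^sup>2" using sq[OF p] by (simp add: norm_power)
      then have "norm (p b * p (Rt s)) \<le> M" using \<open>M \<ge> 0\<close> by (rule power2_le_imp_le)
      then show ?thesis using pa ab(3)[OF p] norm_triangle_ineq[of "p a" "p b * p (Rt s)"] by simp
    qed
    show ?case
    proof (rule le_of_power_le_mult)
      fix k
      have "norm (p (pow t k)) \<le> 2 * M ^ k"
      proof (rule two)
        show "radicands (pow t k) \<subseteq> S" using radicands_pow Suc.prems(3) by blast
        show "norm (v (pow t k)) \<le> M ^ k" if "v \<in> spectrum E g" for v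
          using that Suc.prems(4)[OF that] by (simp add: spectrum_def valuation_pow norm_power power_mono)
      qed
      then show "norm (p t) ^ k \<le> 2 * M ^ k" by (simp add: valuation_pow[OF p] norm_power)
    qed (use ne[OF Suc.prems(4)] in auto)
  qed
  from this[of "radicands t"] show ?thesis
    using finite_radicands radicands_trans M by blast
qed

section \<open>Topology of the space of valuations\<close>

lemma spectrum_bound:
  assumes "\<And>n z. z \<in> E \<Longrightarrow> norm (g n z) \<le> B n"
  shows "\<exists>K. \<forall>v\<in>spectrum E g. norm (v t) \<le> K"
proof (induction t)
  case (Gen n)
  then show ?case using assms by (intro exI[of _ "B n"]) (auto simp: spectrum_def)
next
  case (Cst a b)
  then show ?case
    by (intro exI[of _ "norm (Complex (of_rat a) (of_rat b))"]) (auto simp: spectrum_def valuation_simps)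
next
  case (Add t1 t2)
  then obtain K1 K2 where "\<forall>v\<in>spectrum E g. norm (v t1) \<le> K1" "\<forall>v\<in>spectrum E g. norm (v t2) \<le> K2" by auto
  then show ?case
    by (intro exI[of _ "K1 + K2"]) (auto simp: spectrum_def valuation_simps intro: norm_triangle_mono)
next
  case (Mul t1 t2)
  then obtain K1 K2 where K: "\<forall>v\<in>spectrum E g. norm (v t1) \<le> K1" "\<forall>v\<in>spectrum E g. norm (v t2) \<le> K2" by auto
  have "norm (v (Mul t1 t2)) \<le> K1 * K2" if "v \<in> spectrum E g" for v
  proof -
    have "norm (v t1) \<le> K1" "norm (v t2) \<le> K2" using K that by auto
    then have "norm (v t1) * norm (v t2) \<le> K1 * K2"
      by (intro mult_mono) (auto intro: order_trans[OF norm_ge_zero])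
    then show ?thesis using that by (simp add: spectrum_def valuation_simps norm_mult)
  qed
  then show ?case by blast
next
  case (Rt t)
  then obtain K where K: "\<forall>v\<in>spectrum E g. norm (v t) \<le> K" by auto
  have "norm (v (Rt t)) \<le> K + 1" if v: "v \<in> spectrum E g" for v
  proof -
    have "(v (Rt t))\<^sup>2 = v t" using v by (simp add: spectrum_def valuation_simps)
    then have "(norm (v (Rt t)))\<^sup>2 \<le> K" using K v by (metis norm_power)
    \<comment> \<open>This avoids a square root in the bound: for \<open>x = norm (v (Rt t))\<close>
      it gives \<open>x \<le> 2 * x \<le> x\<^sup>2 + 1 \<le> K + 1\<close>.\<close>
    moreover have "2 * norm (v (Rt t)) \<le> (norm (v (Rt t)))\<^sup>2 + 1"
      using sum_squares_bound[of "norm (v (Rt t))" 1] by simp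
    ultimately show ?thesis using norm_ge_zero[of "v (Rt t)"] by linarith
  qed
  then show ?case by blast
qed

text \<open>By Tychonoff it is enough that the coordinates are bounded and the defining conditions
  closed. The existential condition on \<open>z\<close> is closed because it says that the generator
  coordinates lie in \<open>G\<close>, a compact image of \<open>E\<close>.\<close>

lemma compact_spectrum:
  assumes E: "compact E" and g: "\<And>n. continuous_on E (g n)"
  shows "compact (spectrum E g)"
proof -
  have "\<exists>B. \<forall>z\<in>E. norm (g n z) \<le> B" for n
    using compact_imp_bounded[OF compact_continuous_image[OF g E]] by (auto simp: bounded_iff)
  then obtain B where "\<And>n z. z \<in> E \<Longrightarrow> norm (g n z) \<le> B n" by metis
  then have "\<exists>K. \<forall>v\<in>spectrum E g. norm (v t) \<le> K" for t by (rule spectrum_bound)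
  then obtain K where K: "\<And>t v. v \<in> spectrum E g \<Longrightarrow> norm (v t) \<le> K t" by metis
  have "compactin (product_topology (\<lambda>_::trm. euclidean) UNIV) (PiE UNIV (\<lambda>t. cball (0::complex) (K t)))"
    by (subst compactin_PiE) auto
  then have comp: "compact (PiE UNIV (\<lambda>t. cball (0::complex) (K t)))"
    by (simp add: euclidean_product_topology)
  define G where "G = (\<lambda>z n. g n z) ` E"
  have "compact G" unfolding G_def
    by (intro compact_continuous_image E continuous_on_coordinatewise_then_product g)
  then have "closed G"
    by (rule compact_imp_closed)
  have coord: "continuous_on UNIV (\<lambda>v :: trm \<Rightarrow> complex. v t)" for t
    by (rule continuous_on_product_coordinates)
  have "closed ((\<lambda>v n. v (Gen n)) -` G)"
    using \<open>closed G\<close> by (intro closed_vimage continuous_on_coordinatewise_then_product coord)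
  moreover have "spectrum E g = (\<Inter>a b. {v. v (Cst a b) = Complex (of_rat a) (of_rat b)}) \<inter>
     (\<Inter>s t. {v. v (Add s t) = v s + v t}) \<inter> (\<Inter>s t. {v. v (Mul s t) = v s * v t}) \<inter>
     (\<Inter>t. {v. (v (Rt t))\<^sup>2 = v t}) \<inter> ((\<lambda>v n. v (Gen n)) -` G)"
    by (auto simp: spectrum_def valuation_def G_def image_iff fun_eq_iff)
  ultimately have "closed (spectrum E g)"
    by (auto intro!: closed_Int closed_INT closed_Collect_eq continuous_intros coord)
  moreover have "spectrum E g \<subseteq> PiE UNIV (\<lambda>t. cball (0::complex) (K t))"
    using K by (auto simp: PiE_def)
  ultimately show ?thesis using comp by (metis closed_Int_compact inf.absorb1)
qed

text \<open>On a connected \<open>S\<close> the generator coordinates are constant: \<open>E\<close>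
  is compact and the \<open>g n\<close> separate its points, so the point \<open>z\<close> depends
  continuously on these coordinates and moves in a connected subset of \<open>E\<close>. The other
  coordinates follow by induction on the term; once \<open>v t\<close> is constant,
  \<open>v (Rt t)\<close> ranges over a finite connected set.\<close>

lemma totally_disconnected_spectrum:
  assumes E: "compact E" and g: "\<And>n. continuous_on E (g n)"
    and disc: "totally_disconnected E" and inj: "inj_on (\<lambda>z n. g n z) E"
  shows "totally_disconnected (spectrum E g)"
  unfolding totally_disconnected_def
proof (intro allI impI ballI)
  fix S v w assume "connected S \<and> S \<subseteq> spectrum E g" "v \<in> S" "w \<in> S"
  then have S: "connected S" "S \<subseteq> spectrum E g" "v \<in> S" "w \<in> S" by auto
  have coord: "continuous_on A (\<lambda>v :: trm \<Rightarrow> complex. v t)" for t A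
    by (rule continuous_on_subset[OF continuous_on_product_coordinates]) simp
  define G where "G = (\<lambda>z n. g n z)"
  have "continuous_on E G"
    unfolding G_def by (intro continuous_on_coordinatewise_then_product g)
  moreover have "inj_on G E" using inj by (simp add: G_def)
  ultimately have hcont: "continuous_on (G ` E) (inv_into E G)"
    using E by (intro continuous_on_inv) auto
  have gen: "v (Gen n) = w (Gen n)" if "v \<in> S" "w \<in> S" for v w n
  proof -
    define \<pi> where "\<pi> = (\<lambda>(v :: trm \<Rightarrow> complex) n. v (Gen n))"
    have sub: "\<pi> ` S \<subseteq> G ` E"
      using S(2) by (force simp: \<pi>_def G_def spectrum_def image_iff fun_eq_iff)
    have "continuous_on S \<pi>" unfolding \<pi>_def by (intro continuous_on_coordinatewise_then_product coord)
    then have "connected (inv_into E G ` \<pi> ` S)"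
      by (intro connected_continuous_image S(1) continuous_on_subset[OF hcont sub])
    moreover have "inv_into E G ` \<pi> ` S \<subseteq> E"
    proof
      fix z assume "z \<in> inv_into E G ` \<pi> ` S"
      then obtain u where "u \<in> \<pi> ` S" "z = inv_into E G u" by blast
      then show "z \<in> E" using sub by (metis inv_into_into subsetD)
    qed
    ultimately have "inv_into E G (\<pi> v) = inv_into E G (\<pi> w)" using that by (intro totally_disconnectedD[OF disc]) auto
    then have "\<pi> v = \<pi> w" using sub that by (metis f_inv_into_f imageI subsetD)
    then show ?thesis by (auto simp: \<pi>_def fun_eq_iff)
  qed
  have val: "valuation u" if "u \<in> S" for u using that S(2) by (auto simp: spectrum_def)
  have "\<forall>v\<in>S. \<forall>w\<in>S. v t = w t" for t
  proof (induction t)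
    case (Gen n)
    then show ?case using gen by blast
  next
    case (Cst a b)
    then show ?case by (simp add: valuation_simps val)
  next
    case (Add t u)
    then show ?case by (metis val valuation_simps(2))
  next
    case (Mul t u)
    then show ?case by (metis val valuation_simps(3))
  next
    case (Rt t)
    show ?case
    proof (intro ballI)
      fix v w assume vw: "v \<in> S" "w \<in> S"
      have "u (Rt t) \<in> {csqrt (v t), - csqrt (v t)}" if "u \<in> S" for u
      proof -
        have "(u (Rt t))\<^sup>2 = (csqrt (v t))\<^sup>2"
          using valuation_simps(4)[OF val[OF that]] Rt.IH vw that by simp
        then have "u (Rt t) = csqrt (v t) \<or> u (Rt t) = - csqrt (v t)" by (simp only: power2_eq_iff)
        then show ?thesis by simp
      qed
      then have "(\<lambda>u. u (Rt t)) ` S \<subseteq> {csqrt (v t), - csqrt (v t)}" by auto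
      then have "finite ((\<lambda>u. u (Rt t)) ` S)" by (rule finite_subset) auto
      moreover have "connected ((\<lambda>u. u (Rt t)) ` S)" using S(1) coord by (intro connected_continuous_image)
      ultimately obtain c where "(\<lambda>u. u (Rt t)) ` S \<subseteq> {c}"
        by (metis connected_finite_iff_sing empty_subsetI order_refl)
      then show "v (Rt t) = w (Rt t)" using vw by auto
    qed
  qed
  then show "v = w" using S(3,4) by auto
qed

section \<open>Embedding into the Cantor set\<close>

lemma ternary_bounds:
  fixes d :: "nat \<Rightarrow> nat"
  assumes "\<And>n. d n \<in> {0, 2}"
  shows "summable (\<lambda>n. real (d n) / 3 ^ Suc n)"
    and "0 \<le> (\<Sum>n. real (d n) / 3 ^ Suc n)" "(\<Sum>n. real (d n) / 3 ^ Suc n) \<le> 1"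
proof -
  have g: "(\<lambda>n. 2/3 * (1/3 :: real) ^ n) sums (2/3 * (1 / (1 - 1/3)))"
    by (intro sums_mult geometric_sums) auto
  have le: "real (d n) / 3 ^ Suc n \<le> 2/3 * (1/3) ^ n" for n
    using assms[of n] by (auto simp: power_divide field_simps)
  show sm: "summable (\<lambda>n. real (d n) / 3 ^ Suc n)"
    by (rule summable_comparison_test'[OF sums_summable[OF g], of 0]) (use le in auto)
  show "0 \<le> (\<Sum>n. real (d n) / 3 ^ Suc n)" by (intro suminf_nonneg sm) auto
  have "(\<Sum>n. real (d n) / 3 ^ Suc n) \<le> (\<Sum>n. 2/3 * (1/3 :: real) ^ n)"
    by (intro suminf_le le sm sums_summable[OF g])
  then show "(\<Sum>n. real (d n) / 3 ^ Suc n) \<le> 1" using sums_unique[OF g] by simp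
qed

lemma ternary_rec:
  fixes d :: "nat \<Rightarrow> nat"
  assumes "\<And>n. d n \<in> {0, 2}"
  shows "(\<Sum>n. real (d n) / 3 ^ Suc n) = real (d 0) / 3 + (\<Sum>n. real (d (Suc n)) / 3 ^ Suc n) / 3"
proof -
  have s: "summable (\<lambda>n. real (d n) / 3 ^ Suc n)" "summable (\<lambda>n. real (d (Suc n)) / 3 ^ Suc n)"
    using assms by (intro ternary_bounds(1); blast)+
  have "(\<Sum>n. real (d (Suc n)) / 3 ^ Suc (Suc n)) = (\<Sum>n. real (d (Suc n)) / 3 ^ Suc n / 3)"
    by (simp add: mult.commute)
  also have "\<dots> = (\<Sum>n. real (d (Suc n)) / 3 ^ Suc n) / 3" by (rule suminf_divide[OF s(2)])
  finally show ?thesis using suminf_split_head[OF s(1)] by simp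
qed

text \<open>The tail contributes at most \<open>1/3\<close> to the sum, while leading digits 0 and 2
  contribute amounts that differ by \<open>2/3\<close>.\<close>

lemma ternary_head_unique:
  fixes d e :: "nat \<Rightarrow> nat"
  assumes "\<And>n. d n \<in> {0, 2}" "\<And>n. e n \<in> {0, 2}"
    and "(\<Sum>n. real (d n) / 3 ^ Suc n) = (\<Sum>n. real (e n) / 3 ^ Suc n)"
  shows "d 0 = e 0"
proof -
  have "0 \<le> (\<Sum>n. real (d (Suc n)) / 3 ^ Suc n)" "(\<Sum>n. real (d (Suc n)) / 3 ^ Suc n) \<le> 1"
    "0 \<le> (\<Sum>n. real (e (Suc n)) / 3 ^ Suc n)" "(\<Sum>n. real (e (Suc n)) / 3 ^ Suc n) \<le> 1"
    using ternary_bounds(2,3)[of "\<lambda>n. d (Suc n)"] ternary_bounds(2,3)[of "\<lambda>n. e (Suc n)"] assms by blast+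
  moreover have "real (d 0) / 3 + (\<Sum>n. real (d (Suc n)) / 3 ^ Suc n) / 3
      = real (e 0) / 3 + (\<Sum>n. real (e (Suc n)) / 3 ^ Suc n) / 3"
    using assms(3) by (simp only: ternary_rec[of d, OF assms(1)] ternary_rec[of e, OF assms(2)])
  moreover have "d 0 = 0 \<or> d 0 = 2" using assms(1)[of 0] by blast
  moreover have "e 0 = 0 \<or> e 0 = 2" using assms(2)[of 0] by blast
  ultimately show ?thesis by linarith
qed

lemma ternary_unique:
  fixes d e :: "nat \<Rightarrow> nat"
  assumes "\<And>n. d n \<in> {0, 2}" "\<And>n. e n \<in> {0, 2}"
    and "(\<Sum>n. real (d n) / 3 ^ Suc n) = (\<Sum>n. real (e n) / 3 ^ Suc n)"
  shows "d k = e k"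
  using assms
proof (induction k arbitrary: d e)
  case (0 d e)
  then show ?case by (rule ternary_head_unique)
next
  case (Suc k d e)
  have "d 0 = e 0" using Suc.prems by (rule ternary_head_unique)
  moreover have "real (d 0) / 3 + (\<Sum>n. real (d (Suc n)) / 3 ^ Suc n) / 3
      = real (e 0) / 3 + (\<Sum>n. real (e (Suc n)) / 3 ^ Suc n) / 3"
    using Suc.prems(3) by (simp only: ternary_rec[of d, OF Suc.prems(1)] ternary_rec[of e, OF Suc.prems(2)])
  ultimately have "(\<Sum>n. real (d (Suc n)) / 3 ^ Suc n) = (\<Sum>n. real (e (Suc n)) / 3 ^ Suc n)" by linarith
  then show ?case
    using Suc.IH[of "\<lambda>n. d (Suc n)" "\<lambda>n. e (Suc n)"] Suc.prems(1,2) by blast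
qed

lemma Hausdorff_space_t2: "Hausdorff_space (euclidean :: 'a::t2_space topology)"
  unfolding Hausdorff_space_def
proof (intro allI impI)
  fix x y :: 'a assume "x \<in> topspace euclidean \<and> y \<in> topspace euclidean \<and> x \<noteq> y"
  then obtain U V where "open U" "open V" "x \<in> U" "y \<in> V" "U \<inter> V = {}"
    using hausdorff[of x y] by auto
  then show "\<exists>U V. openin euclidean U \<and> openin euclidean V \<and> x \<in> U \<and> y \<in> V \<and> disjnt U V"
    by (intro exI[of _ U] exI[of _ V]) (auto simp: disjnt_def)
qed

text \<open>In a compact Hausdorff space components and quasi-components coincide, and points in
  distinct quasi-components are by definition separated by clopen sets.\<close>

lemma clopen_separation:
  fixes X :: "'b::t2_space set"
  assumes "compact X" and disc: "totally_disconnected X"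
    and xy: "x \<in> X" "y \<in> X" "x \<noteq> y"
  obtains T where "openin (top_of_set X) T" "closedin (top_of_set X) T" "x \<in> T" "y \<notin> T"
proof -
  have "quasi_component_of (top_of_set X) x = connected_component_of (top_of_set X) x"
    using assms(1) by (intro quasi_eq_connected_component_of)
      (auto simp: compact_space_subtopology Hausdorff_space_subtopology Hausdorff_space_t2)
  moreover have "\<not> connected_component_of (top_of_set X) x y"
    using disc xy(3) by (auto simp: totally_disconnected_def connected_component_of_def connectedin_subtopology)
  ultimately have "\<not> quasi_component_of (top_of_set X) x y" by simp
  then show ?thesis using xy that by (auto simp: quasi_component_of)
qed

text \<open>A sequence of clopen sets that separates the points of \<open>X\<close> gives each point
  an itinerary, read as a ternary expansion with digits 0 and 2. Second countability provides such a
  sequence.\<close>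

lemma embed_in_cantor_set:
  fixes X :: "'b::{second_countable_topology, t2_space} set"
  assumes X: "compact X" and disc: "totally_disconnected X"
  obtains f :: "'b \<Rightarrow> real" where "continuous_on X f" "inj_on f X" "f ` X \<subseteq> cantor_set"
proof -
  obtain \<B> :: "'b set set" where "countable \<B> \<and> topological_basis \<B>"
    using ex_countable_basis ..
  then have \<B>: "countable \<B>" "topological_basis \<B>" by auto
  define clopen where "clopen T \<longleftrightarrow> openin (top_of_set X) T \<and> closedin (top_of_set X) T" for T
  \<comment> \<open>One clopen set per pair of basic open sets is enough: a clopen \<open>T\<close>
    that contains \<open>x\<close> but not \<open>y\<close> includes the trace on \<open>X\<close>
    of a basic neighbourhood of \<open>x\<close> and misses that of one of \<open>y\<close>.\<close>
  define pick where "pick = (\<lambda>(U, V). SOME T. clopen T \<and> U \<inter> X \<subseteq> T \<and> V \<inter> X \<inter> T = {})"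
  define \<K> where "\<K> = insert {} {T \<in> pick ` (\<B> \<times> \<B>). clopen T}"
  have "countable (pick ` (\<B> \<times> \<B>))" using \<B>(1) by (intro countable_image countable_SIGMA)
  then have "countable \<K>" unfolding \<K>_def
    by (intro countable_insert) (rule countable_subset[rotated], assumption, blast)
  define K where "K = from_nat_into \<K>"
  have K: "K n \<in> \<K>" for n unfolding K_def by (rule from_nat_into) (auto simp: \<K>_def)
  have clK: "clopen (K n)" for n using K[of n] by (auto simp: \<K>_def clopen_def)
  have sepK: "\<exists>n. x \<in> K n \<and> y \<notin> K n" if xy: "x \<in> X" "y \<in> X" "x \<noteq> y" for x y
  proof -
    obtain T where T: "clopen T" "x \<in> T" "y \<notin> T"
      using clopen_separation[OF X disc xy] unfolding clopen_def by metis
    obtain O1 where O1: "open O1" "T = X \<inter> O1" using T by (auto simp: clopen_def openin_open)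
    obtain C where C: "closed C" "T = X \<inter> C" using T by (auto simp: clopen_def closedin_closed)
    obtain U where U: "U \<in> \<B>" "x \<in> U" "U \<subseteq> O1"
      using topological_basisE[OF \<B>(2) O1(1)] O1(2) T(2) by blast
    obtain V where V: "V \<in> \<B>" "y \<in> V" "V \<subseteq> - C"
      using topological_basisE[OF \<B>(2), of "- C" y] C T(3) xy by blast
    have "clopen T \<and> U \<inter> X \<subseteq> T \<and> V \<inter> X \<inter> T = {}" using T U V O1 C by auto
    then have p: "clopen (pick (U, V)) \<and> U \<inter> X \<subseteq> pick (U, V) \<and> V \<inter> X \<inter> pick (U, V) = {}"
      unfolding pick_def by (simp, rule someI)
    then have "pick (U, V) \<in> \<K>" using U V by (auto simp: \<K>_def)
    then obtain n where "K n = pick (U, V)"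
      using from_nat_into_surj[OF \<open>countable \<K>\<close>] unfolding K_def by metis
    then show ?thesis using p U V xy by blast
  qed
  define d where "d x n = (if x \<in> K n then 2 else 0 :: nat)" for x n
  have d: "d x n \<in> {0, 2}" for x n by (simp add: d_def)
  define f where "f x = (\<Sum>n. real (d x n) / 3 ^ Suc n)" for x
  have dcont: "continuous_on X (\<lambda>x. real (d x n))" for n
  proof -
    have XK: "K n \<union> (X - K n) = X" using clK[of n] by (auto simp: clopen_def dest: openin_imp_subset)
    have "closedin (top_of_set X) (X - K n)"
      using clK[of n] closedin_diff[of "top_of_set X" X "K n"] by (auto simp: clopen_def)
    then have "continuous_on (K n \<union> (X - K n)) (\<lambda>x. if x \<in> K n then 2 else 0 :: real)"
      using clK[of n] XK by (intro continuous_on_cases_local) (auto simp: clopen_def)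
    then show ?thesis unfolding XK by (simp add: d_def if_distrib[of real] cong: if_cong)
  qed
  have "uniform_limit X (\<lambda>k x. \<Sum>n<k. real (d x n) / 3 ^ Suc n) f sequentially"
    unfolding f_def
  proof (rule Weierstrass_m_test[where M = "\<lambda>n. 2/3 * (1/3) ^ n"])
    show "norm (real (d x n) / 3 ^ Suc n) \<le> 2/3 * (1/3) ^ n" for x n
      by (auto simp: d_def power_divide field_simps)
    show "summable (\<lambda>n. 2/3 * (1/3::real) ^ n)" by (intro summable_mult summable_geometric) auto
  qed
  then have "continuous_on X f"
    by (rule uniform_limit_theorem[rotated]) (auto intro!: always_eventually continuous_intros dcont)
  moreover have "inj_on f X"
  proof (rule inj_onI, rule ccontr)
    fix x y assume xy: "x \<in> X" "y \<in> X" "f x = f y" "x \<noteq> y"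
    obtain n where "x \<in> K n" "y \<notin> K n" using sepK xy by blast
    moreover have "d x n = d y n" by (rule ternary_unique) (use d xy in \<open>auto simp: f_def\<close>)
    ultimately show False by (simp add: d_def)
  qed
  moreover have "f ` X \<subseteq> cantor_set" using d by (auto simp: cantor_set_def f_def)
  ultimately show ?thesis by (rule that)
qed

section \<open>Characters and analytic discs\<close>

text \<open>A root-free term is a polynomial in the \<open>g n\<close>, whose limit at infinity is
  in general nonzero because of the constants. Hence the maximum principle is needed in a form that
  admits any limit.\<close>

lemma root_free_term_analytic:
  assumes g: "\<And>n. continuous_on UNIV (g n)" "\<And>n. g n holomorphic_on - E" "\<And>n. (g n \<longlongrightarrow> 0) at_infinity"
    and "radicands t = {}"
  shows "continuous_on UNIV (\<lambda>z. principal_value (\<lambda>n. g n z) t) \<and>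
     (\<lambda>z. principal_value (\<lambda>n. g n z) t) holomorphic_on - E \<and>
     (\<exists>c. ((\<lambda>z. principal_value (\<lambda>n. g n z) t) \<longlongrightarrow> c) at_infinity)"
  using assms(4)
proof (induction t)
  case (Gen n)
  then show ?case using g by auto
next
  case (Cst a b)
  then show ?case by auto
next
  case (Add t u)
  then show ?case by (auto intro!: continuous_intros holomorphic_intros intro: tendsto_add)
next
  case (Mul t u)
  then show ?case by (auto intro!: continuous_intros holomorphic_intros intro: tendsto_mult)
qed simp

lemma exists_nontrivial_valuation:
  obtains X :: "(trm \<Rightarrow> complex) set" and p
  where "compact X" "totally_disconnected X" "\<forall>v\<in>X. valuation v" "valuation p" "p \<notin> X"
    "\<forall>t M. (\<forall>v\<in>X. norm (v t) \<le> M) \<longrightarrow> norm (p t) \<le> M"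
proof -
  obtain E :: "complex set" and g :: "nat \<Rightarrow> complex \<Rightarrow> complex" and z0 :: complex
    where E: "compact E" "z0 \<notin> E" "E \<noteq> {}" "totally_disconnected E"
      and g: "\<forall>n. continuous_on UNIV (g n)" "\<forall>n. g n holomorphic_on - E" "\<forall>n. (g n \<longlongrightarrow> 0) at_infinity"
      and gz: "g 0 z0 \<noteq> 0" and inj: "inj_on (\<lambda>z n. g n z) (insert z0 E)"
    by (rule totally_disconnected_with_separating_transforms)
  define X where "X = spectrum E g"
  define p where "p = principal_value (\<lambda>n. g n z0)"
  have contE: "continuous_on E (g n)" for n using g(1) continuous_on_subset by blast
  have base: "norm (p t) \<le> M"
    if t: "radicands t = {}" and M: "\<And>v. v \<in> spectrum E g \<Longrightarrow> norm (v t) \<le> M" for t M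
  proof -
    define F where "F z = principal_value (\<lambda>n. g n z) t" for z
    have F: "continuous_on UNIV F" "F holomorphic_on - E" "\<exists>c. (F \<longlongrightarrow> c) at_infinity"
      using root_free_term_analytic[of g E t] g t unfolding F_def by blast+
    then obtain c where c: "(F \<longlongrightarrow> c) at_infinity" by blast
    have bd: "norm (F w) \<le> M" if "w \<in> E" for w
      unfolding F_def using that by (intro M) (auto simp: spectrum_def valuation_principal_value)
    moreover have "M \<ge> 0" using E(3) bd norm_ge_zero order_trans by blast
    ultimately have "norm (F z0) \<le> M"
      using norm_le_of_limit_at_infinity[of E z0 "g 0" F c M] E(1,2) gz F(1,2) c g by blast
    then show ?thesis by (simp add: F_def p_def)
  qed
  show ?thesis
  proof (rule that[of X p])
    show "compact X" unfolding X_def by (rule compact_spectrum[OF E(1) contE])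
    show "totally_disconnected X"
      unfolding X_def by (rule totally_disconnected_spectrum[OF E(1) contE E(4) inj_on_subset[OF inj]]) auto
    show vp: "valuation p" unfolding p_def by (rule valuation_principal_value)
    show "\<forall>v\<in>X. valuation v" by (auto simp: X_def spectrum_def)
    show "p \<notin> X"
    proof
      assume "p \<in> X"
      then obtain z where z: "z \<in> E" "\<And>n. g n z0 = g n z" by (auto simp: X_def spectrum_def p_def)
      then have "z0 = z" by (intro inj_onD[OF inj]) auto
      then show False using z E by simp
    qed
    show "\<forall>t M. (\<forall>v\<in>X. norm (v t) \<le> M) \<longrightarrow> norm (p t) \<le> M"
      using norm_le_spectral_norm[OF vp base] unfolding X_def by blast
  qed
qed

text \<open>Infinite descent on the order of the zero, with \<open>R\<close> as an abstract root
  operation on indices: if \<open>H i\<close> is not identically zero on \<open>D\<close>, neither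
  is \<open>H (R i)\<close>, and its order at \<open>z\<close> is positive and half as
  large.\<close>

lemma zero_of_iterated_roots:
  fixes H :: "'i \<Rightarrow> complex \<Rightarrow> complex"
  assumes D: "open D" "connected D" "z \<in> D"
    and hol: "\<And>i. H i holomorphic_on D" and root: "\<And>i w. w \<in> D \<Longrightarrow> (H (R i) w)\<^sup>2 = H i w"
    and "H i z = 0" "w \<in> D"
  shows "H i w = 0"
proof (rule ccontr)
  assume "H i w \<noteq> 0"
  then have "\<exists>w\<in>D. H i w \<noteq> 0" using assms by blast
  then show False using \<open>H i z = 0\<close>
  proof (induction "nat (zorder (H i) z)" arbitrary: i rule: less_induct)
    case less
    have nz: "\<exists>w\<in>D. H (R i) w \<noteq> 0"
    proof -
      obtain w where "w \<in> D" "H i w \<noteq> 0" using less.prems(1) by blast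
      then show ?thesis using root[of w i] by (intro bexI[of _ w]) auto
    qed
    have z: "H (R i) z = 0" using less.prems(2) root[OF D(3), of i] by simp
    define n where "n = zorder (H (R i)) z"
    obtain r g where n: "n > 0" and r: "r > 0" "cball z r \<subseteq> D" "g holomorphic_on cball z r"
      "\<And>w. w \<in> cball z r \<Longrightarrow> H (R i) w = g w * (w - z) ^ nat n \<and> g w \<noteq> 0"
      using zorder_exist_zero[OF hol D nz] z unfolding n_def by auto
    have "zorder (H i) z = 2 * n"
    proof (rule zorder_eqI[of "ball z r" _ "\<lambda>w. (g w)\<^sup>2"])
      show "(\<lambda>w. (g w)\<^sup>2) holomorphic_on ball z r"
        by (intro holomorphic_intros holomorphic_on_subset[OF r(3)]) auto
      show "(g z)\<^sup>2 \<noteq> 0" using r by simp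
      show "H i w = (g w)\<^sup>2 * (w - z) powi (2 * n)" if "w \<in> ball z r" "w \<noteq> z" for w
      proof -
        have "w \<in> cball z r" using that by simp
        then have "H i w = (g w * (w - z) ^ nat n)\<^sup>2" using root[of w i] r(2,4) by (metis subsetD)
        also have "\<dots> = (g w)\<^sup>2 * ((w - z) powi n)\<^sup>2" using n by (simp add: power_int_def power_mult_distrib)
        also have "((w - z) powi n)\<^sup>2 = (w - z) powi (2 * n)"
          using power_int_add[of "w - z" n n] that by (simp only: power2_eq_square mult_2) auto
        finally show ?thesis .
      qed
    qed (use r in auto)
    then have "nat (zorder (H (R i)) z) < nat (zorder (H i) z)" using n by (simp add: n_def)
    then show False using less.hyps nz z by blast
  qed
qed

lemma real_holomorphic_constant:
  assumes "h holomorphic_on ball 0 1" "\<And>z. z \<in> ball 0 1 \<Longrightarrow> Im (h z) = 0"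
  shows "h constant_on ball 0 1"
proof (rule ccontr)
  assume "\<not> h constant_on ball 0 1"
  then have "open (h ` ball 0 1)"
    by (intro open_mapping_thm[OF assms(1)]) auto
  then have "open (h ` ball 0 1)" "h 0 \<in> h ` ball 0 1" by auto
  then obtain e where e: "e > 0" "ball (h 0) e \<subseteq> h ` ball 0 1" by (meson open_contains_ball)
  have "h 0 + \<i> * of_real (e/2) \<in> ball (h 0) e" using e(1) by (simp add: dist_norm norm_mult)
  then obtain z where "z \<in> ball 0 1" "h z = h 0 + \<i> * of_real (e/2)" using e(2) by (metis imageE subsetD)
  then show False using assms(2)[of z] assms(2)[of 0] e(1) by simp
qed

lemma rational_point_in_open:
  assumes "open U" "c \<in> U"
  obtains a b where "Complex (of_rat a) (of_rat b) \<in> U"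
proof -
  obtain e where e: "e > 0" "ball c e \<subseteq> U" using assms by (meson open_contains_ball)
  obtain a where a: "Re c < of_rat a" "of_rat a < Re c + e/2" using of_rat_dense[of "Re c" "Re c + e/2"] e by auto
  obtain b where b: "Im c < of_rat b" "of_rat b < Im c + e/2" using of_rat_dense[of "Im c" "Im c + e/2"] e by auto
  have "norm (c - Complex (of_rat a) (of_rat b)) \<le> \<bar>Re c - of_rat a\<bar> + \<bar>Im c - of_rat b\<bar>"
    using cmod_le[of "c - Complex (of_rat a) (of_rat b)"] by simp
  then have "Complex (of_rat a) (of_rat b) \<in> ball c e" using a b by (simp add: dist_norm)
  then show ?thesis using e that by blast
qed

section \<open>Automatic continuity of characters\<close>

lemma uniform_algebraD:
  assumes "uniform_algebra A"
  shows "f \<in> A \<Longrightarrow> continuous_on UNIV f" "(\<lambda>_. c) \<in> A"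
    "f \<in> A \<Longrightarrow> g \<in> A \<Longrightarrow> (\<lambda>x. f x + g x) \<in> A"
    "f \<in> A \<Longrightarrow> g \<in> A \<Longrightarrow> (\<lambda>x. f x * g x) \<in> A"
    "f \<in> A \<Longrightarrow> (\<lambda>x. c * f x) \<in> A"
proof -
  have "\<forall>f\<in>A. continuous_on UNIV f" and "\<forall>c. (\<lambda>_. c) \<in> A"
    and "\<forall>f\<in>A. \<forall>g\<in>A. (\<lambda>x. f x + g x) \<in> A"
    and "\<forall>f\<in>A. \<forall>g\<in>A. (\<lambda>x. f x * g x) \<in> A" and "\<forall>c. \<forall>f\<in>A. (\<lambda>x. c * f x) \<in> A"
    using assms unfolding uniform_algebra_def by - (elim conjE, assumption)+
  note * = this[rule_format]
  show "f \<in> A \<Longrightarrow> continuous_on UNIV f" by (rule *(1))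
  show "(\<lambda>_. c) \<in> A" by (rule *(2))
  show "f \<in> A \<Longrightarrow> g \<in> A \<Longrightarrow> (\<lambda>x. f x + g x) \<in> A" by (rule *(3))
  show "f \<in> A \<Longrightarrow> g \<in> A \<Longrightarrow> (\<lambda>x. f x * g x) \<in> A" by (rule *(4))
  show "f \<in> A \<Longrightarrow> (\<lambda>x. c * f x) \<in> A" by (rule *(5))
qed

lemma uniform_algebra_limit:
  assumes "uniform_algebra A" "\<And>n. F n \<in> A" "uniform_limit UNIV F g sequentially"
  shows "g \<in> A"
proof -
  have "\<forall>F g. (\<forall>n. F n \<in> A) \<and> uniform_limit UNIV F g sequentially \<longrightarrow> g \<in> A"
    using assms(1) unfolding uniform_algebra_def by (elim conjE)
  from this[rule_format, of F g] show ?thesis using assms(2,3) by blast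
qed

lemma characterD:
  assumes "character A \<phi>"
  shows "f \<in> A \<Longrightarrow> g \<in> A \<Longrightarrow> \<phi> (\<lambda>x. f x + g x) = \<phi> f + \<phi> g"
    "f \<in> A \<Longrightarrow> g \<in> A \<Longrightarrow> \<phi> (\<lambda>x. f x * g x) = \<phi> f * \<phi> g"
    "f \<in> A \<Longrightarrow> \<phi> (\<lambda>x. c * f x) = c * \<phi> f"
proof -
  have "\<forall>f\<in>A. \<forall>g\<in>A. \<phi> (\<lambda>x. f x + g x) = \<phi> f + \<phi> g" and "\<forall>c. \<forall>f\<in>A. \<phi> (\<lambda>x. c * f x) = c * \<phi> f"
    and "\<forall>f\<in>A. \<forall>g\<in>A. \<phi> (\<lambda>x. f x * g x) = \<phi> f * \<phi> g"
    using assms unfolding character_def by - (elim conjE, assumption)+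
  note * = this[rule_format]
  show "f \<in> A \<Longrightarrow> g \<in> A \<Longrightarrow> \<phi> (\<lambda>x. f x + g x) = \<phi> f + \<phi> g" by (rule *(1))
  show "f \<in> A \<Longrightarrow> g \<in> A \<Longrightarrow> \<phi> (\<lambda>x. f x * g x) = \<phi> f * \<phi> g" by (rule *(3))
  show "f \<in> A \<Longrightarrow> \<phi> (\<lambda>x. c * f x) = c * \<phi> f" by (rule *(2))
qed

lemma character_const:
  assumes "uniform_algebra A" "character A \<phi>"
  shows "\<phi> (\<lambda>_. c) = c"
proof -
  obtain f where f: "f \<in> A" "\<phi> f \<noteq> 0" using assms by (auto simp: character_def)
  note one = uniform_algebraD(2)[OF assms(1), of 1]
  have "\<phi> (\<lambda>x. (\<lambda>_. 1) x * f x) = \<phi> (\<lambda>_. 1) * \<phi> f"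
    by (rule characterD(2)[OF assms(2) one f(1)])
  then have "\<phi> (\<lambda>_. 1) = 1" using f(2) by simp
  moreover have "\<phi> (\<lambda>x. c * (\<lambda>_. 1) x) = c * \<phi> (\<lambda>_. 1)"
    by (rule characterD(3)[OF assms(2) one])
  ultimately show ?thesis by simp
qed

text \<open>Continuity is not part of \<open>character\<close> and has to be derived. If
  \<open>l = \<phi> f\<close> exceeded \<open>M\<close> in modulus, the geometric series in
  \<open>f / l\<close> would converge in \<open>A\<close> and invert \<open>f - l\<close> up to a
  constant factor, although \<open>\<phi>\<close> kills \<open>f - l\<close>.\<close>

lemma character_norm_le:
  assumes A: "uniform_algebra A" and \<phi>: "character A \<phi>" and f: "f \<in> A" "\<And>x. norm (f x) \<le> M"
  shows "norm (\<phi> f) \<le> M"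
proof (rule ccontr)
  assume less: "\<not> norm (\<phi> f) \<le> M"
  define l where "l = \<phi> f"
  have "M \<ge> 0" using f(2) norm_ge_zero order_trans by blast
  then have l: "norm l > M" "l \<noteq> 0" using less by (auto simp: l_def)
  note const = uniform_algebraD(2)[OF A] and add = uniform_algebraD(3)[OF A] and mul = uniform_algebraD(4)[OF A]
  have fl: "(\<lambda>x. f x / l) \<in> A" using mul[OF f(1) const[of "1 / l"]] by simp
  have pow: "(\<lambda>x. (f x / l) ^ n) \<in> A" for n
    by (induction n) (use const[of 1] mul[OF fl] in auto)
  have partial: "(\<lambda>x. \<Sum>n<k. (f x / l) ^ n) \<in> A" for k
    by (induction k) (use const[of 0] add pow in auto)
  have small: "norm (f x / l) \<le> M / norm l" for x
    using f(2)[of x] by (simp add: norm_divide divide_right_mono)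
  have q: "M / norm l < 1" using l \<open>M \<ge> 0\<close> by (simp add: divide_less_eq)
  have "uniform_limit UNIV (\<lambda>k x. \<Sum>n<k. (f x / l) ^ n) (\<lambda>x. \<Sum>n. (f x / l) ^ n) sequentially"
  proof (rule Weierstrass_m_test[where M = "\<lambda>n. (M / norm l) ^ n"])
    show "norm ((f x / l) ^ n) \<le> (M / norm l) ^ n" for x n
      unfolding norm_power by (intro power_mono small) auto
    show "summable (\<lambda>n. (M / norm l) ^ n)"
      using q \<open>M \<ge> 0\<close> by (intro summable_geometric) auto
  qed
  then have inv: "(\<lambda>x. \<Sum>n. (f x / l) ^ n) \<in> A" (is "?h \<in> A")
    by (rule uniform_algebra_limit[OF A partial])
  have eq: "?h x * (f x + - l) = - l" for x
  proof -
    have "norm (f x / l) < 1" using small[of x] q by linarith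
    then have "?h x = 1 / (1 - f x / l)" by (rule suminf_geometric)
    moreover have "f x \<noteq> l" using \<open>norm (f x / l) < 1\<close> l(2) by auto
    ultimately show ?thesis using l(2) by (simp add: field_simps)
  qed
  have fm: "(\<lambda>x. f x + (\<lambda>_. - l) x) \<in> A" by (rule add[OF f(1) const])
  have "\<phi> (\<lambda>x. f x + (\<lambda>_. - l) x) = \<phi> f + \<phi> (\<lambda>_. - l)"
    by (rule characterD(1)[OF \<phi> f(1) const])
  then have "\<phi> (\<lambda>x. f x + (\<lambda>_. - l) x) = 0" using character_const[OF A \<phi>] by (simp add: l_def)
  moreover have "\<phi> (\<lambda>x. ?h x * (\<lambda>x. f x + (\<lambda>_. - l) x) x) = \<phi> ?h * \<phi> (\<lambda>x. f x + (\<lambda>_. - l) x)"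
    by (rule characterD(2)[OF \<phi> inv fm])
  ultimately have "\<phi> (\<lambda>_. - l) = 0" using eq by simp
  then show False using character_const[OF A \<phi>] l(2) by simp
qed

section \<open>The algebra on the whole space\<close>

lemma normal_space_compact_t2:
  assumes "compact (UNIV :: 'a::t2_space set)"
  shows "normal_space (euclidean :: 'a topology)"
  using assms by (intro compact_Hausdorff_or_regular_imp_normal_space)
    (auto simp: Hausdorff_space_t2 compact_space_def)

lemma Tietze_real:
  fixes f :: "'a::t2_space \<Rightarrow> real"
  assumes "compact (UNIV :: 'a set)" "closed Y" "continuous_on Y f" "\<And>y. y \<in> Y \<Longrightarrow> \<bar>f y\<bar> \<le> e" "e \<ge> 0"
  obtains F where "continuous_on UNIV F" "\<And>y. y \<in> Y \<Longrightarrow> F y = f y" "\<And>x. \<bar>F x\<bar> \<le> e"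
proof -
  have im: "f ` Y \<subseteq> {-e..e}" using assms(4) by (force simp: abs_le_iff)
  have le: "-e \<le> e" using assms(5) by simp
  have cl: "closedin euclidean Y" and cm: "continuous_map (top_of_set Y) euclideanreal f"
    using assms(2,3) by auto
  show ?thesis
  proof (rule Tietze_extension_closed_real_interval[OF normal_space_compact_t2[OF assms(1)] cl cm im le])
    fix F assume F: "continuous_map euclidean euclideanreal F" "\<And>y. y \<in> Y \<Longrightarrow> F y = f y"
      "F ` topspace euclidean \<subseteq> {-e..e}"
    have "\<bar>F x\<bar> \<le> e" for x
    proof -
      have "F x \<in> {-e..e}" using F(3) by (simp add: image_subset_iff)
      then show ?thesis by (simp add: abs_le_iff)
    qed
    then show ?thesis using F(1,2) by (intro that[of F]) auto
  qed
qed

text \<open>Real and imaginary parts are extended separately, which costs the factor 2.\<close>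

lemma Tietze_complex:
  fixes f :: "'a::t2_space \<Rightarrow> complex"
  assumes "compact (UNIV :: 'a set)" "closed Y" "continuous_on Y f" "\<And>y. y \<in> Y \<Longrightarrow> norm (f y) \<le> e" "e \<ge> 0"
  obtains F where "continuous_on UNIV F" "\<And>y. y \<in> Y \<Longrightarrow> F y = f y" "\<And>x. norm (F x) \<le> 2 * e"
proof -
  obtain R where R: "continuous_on UNIV R" "\<And>y. y \<in> Y \<Longrightarrow> R y = Re (f y)" "\<And>x. \<bar>R x\<bar> \<le> e"
  proof (rule Tietze_real[OF assms(1,2), of "\<lambda>y. Re (f y)" e])
    show "\<bar>Re (f y)\<bar> \<le> e" if "y \<in> Y" for y
      using assms(4)[OF that] abs_Re_le_cmod[of "f y"] by linarith
  qed (use assms in \<open>auto intro!: continuous_intros\<close>)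
  obtain I where I: "continuous_on UNIV I" "\<And>y. y \<in> Y \<Longrightarrow> I y = Im (f y)" "\<And>x. \<bar>I x\<bar> \<le> e"
  proof (rule Tietze_real[OF assms(1,2), of "\<lambda>y. Im (f y)" e])
    show "\<bar>Im (f y)\<bar> \<le> e" if "y \<in> Y" for y
      using assms(4)[OF that] abs_Im_le_cmod[of "f y"] by linarith
  qed (use assms in \<open>auto intro!: continuous_intros\<close>)
  show ?thesis
  proof (rule that[of "\<lambda>x. Complex (R x) (I x)"])
    show "continuous_on UNIV (\<lambda>x. Complex (R x) (I x))" using R(1) I(1) by (rule continuous_on_Complex)
    show "norm (Complex (R x) (I x)) \<le> 2 * e" for x
      using cmod_le[of "Complex (R x) (I x)"] R(3)[of x] I(3)[of x] by simp
  qed (use R(2) I(2) in \<open>auto simp: complex_eq_iff\<close>)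
qed

text \<open>All that is retained of \<open>E\<close> and the Cauchy transforms is
  \<open>p_bound\<close>: on terms, \<open>p\<close> is dominated by the supremum over
  \<open>X\<close>.\<close>

locale embedded_spectrum =
  fixes X :: "(trm \<Rightarrow> complex) set" and p :: "trm \<Rightarrow> complex" and j :: "(trm \<Rightarrow> complex) \<Rightarrow> 'a::t2_space"
  assumes K: "compact (UNIV :: 'a set)" and X: "compact X"
    and val: "\<And>v. v \<in> X \<Longrightarrow> valuation v" and val_p: "valuation p" and p_notin: "p \<notin> X"
    and p_bound: "\<And>t M. (\<And>v. v \<in> X \<Longrightarrow> norm (v t) \<le> M) \<Longrightarrow> norm (p t) \<le> M"
    and j: "continuous_on X j" "inj_on j X"
begin

definition extends :: "('a \<Rightarrow> complex) \<Rightarrow> trm \<Rightarrow> bool" where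
  "extends f t \<longleftrightarrow> continuous_on UNIV f \<and> (\<forall>v\<in>X. f (j v) = v t)"

text \<open>Only the values on the image of \<open>j\<close> are constrained. Terms are not closed
  under complex scalars, their constants being rational; approximation up to \<open>e\<close>
  restores all scalars.\<close>

definition alg :: "('a \<Rightarrow> complex) set" where
  "alg = {f. continuous_on UNIV f \<and> (\<forall>e>0. \<exists>t. \<forall>v\<in>X. norm (f (j v) - v t) \<le> e)}"

lemma closed_image: "closed (j ` X)"
  using X j by (intro compact_imp_closed compact_continuous_image)

lemma continuous_coord: "continuous_on X (\<lambda>v. v t)"
  by (rule continuous_on_subset[OF continuous_on_product_coordinates]) simp

lemma continuous_inverse:
  "\<exists>k. (\<forall>v\<in>X. k (j v) = v) \<and> (\<forall>t. continuous_on (j ` X) (\<lambda>y. k y t))"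
proof (intro exI conjI ballI allI)
  show k: "inv_into X j (j v) = v" if "v \<in> X" for v using j(2) that by simp
  have "continuous_on (j ` X) (inv_into X j)" using j X k by (intro continuous_on_inv) auto
  then show "continuous_on (j ` X) (\<lambda>y. inv_into X j y t)" for t
    by (rule continuous_on_compose2[OF continuous_coord]) (auto simp: k)
qed

lemma X_nonempty: "X \<noteq> {}"
proof
  assume "X = {}"
  then have "norm (p (Gen 0)) \<le> -1" by (intro p_bound) auto
  then show False using norm_ge_zero[of "p (Gen 0)"] by linarith
qed

lemma extends_in_alg: "extends f t \<Longrightarrow> f \<in> alg"
  unfolding extends_def alg_def by (auto intro!: exI[of _ t])

text \<open>By definition \<open>f\<close> is close to a term only on the image of \<open>j\<close>.
  Subtracting a small Tietze extension of the error gives an exact extension of the term that is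
  close to \<open>f\<close> on the whole space, as the norm bound for characters demands. Starting
  from \<open>e/2\<close> absorbs the factor 2.\<close>

lemma approx_extends:
  assumes "f \<in> alg" "e > 0"
  obtains F t where "extends F t" "\<And>x. norm (f x - F x) \<le> e"
proof -
  have f: "continuous_on UNIV f" using assms by (simp add: alg_def)
  have "\<forall>e>0. \<exists>t. \<forall>v\<in>X. norm (f (j v) - v t) \<le> e" using assms(1) by (simp add: alg_def)
  then obtain t where t: "\<And>v. v \<in> X \<Longrightarrow> norm (f (j v) - v t) \<le> e/2" using half_gt_zero[OF assms(2)] by blast
  obtain k where "\<forall>v\<in>X. k (j v) = v" "\<forall>t. continuous_on (j ` X) (\<lambda>y. k y t)"
    using continuous_inverse by (elim exE conjE)
  then have k: "\<And>v. v \<in> X \<Longrightarrow> k (j v) = v" and kcont: "\<And>t. continuous_on (j ` X) (\<lambda>y. k y t)"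
    by auto
  have "continuous_on (j ` X) (\<lambda>y. f y - k y t)"
    by (intro continuous_on_diff continuous_on_subset[OF f] kcont) auto
  then obtain d where d: "continuous_on UNIV d" "\<And>y. y \<in> j ` X \<Longrightarrow> d y = f y - k y t" "\<And>x. norm (d x) \<le> 2 * (e/2)"
    by (rule Tietze_complex[OF K closed_image, where e = "e/2"]) (use t k assms(2) in auto)
  show ?thesis
  proof (rule that[of "\<lambda>x. f x - d x" t])
    show "extends (\<lambda>x. f x - d x) t"
      unfolding extends_def using f d(1,2) k by (auto intro!: continuous_intros)
    show "norm (f x - (f x - d x)) \<le> e" for x using d(3)[of x] by simp
  qed
qed

lemma bounded_coord: "\<exists>B. \<forall>v\<in>X. norm (v t) \<le> B"
  using compact_imp_bounded[OF compact_continuous_image[OF continuous_coord X]] by (auto simp: bounded_iff)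

lemma exists_extends: obtains f where "extends f t"
proof -
  obtain k where "\<forall>v\<in>X. k (j v) = v" "\<forall>t. continuous_on (j ` X) (\<lambda>y. k y t)"
    using continuous_inverse by (elim exE conjE)
  then have k: "\<And>v. v \<in> X \<Longrightarrow> k (j v) = v" and kcont: "\<And>t. continuous_on (j ` X) (\<lambda>y. k y t)"
    by auto
  obtain B where B: "\<And>v. v \<in> X \<Longrightarrow> norm (v t) \<le> B" using bounded_coord by blast
  have "B \<ge> 0" using X_nonempty B norm_ge_zero order_trans by blast
  obtain F where "continuous_on UNIV F" "\<And>y. y \<in> j ` X \<Longrightarrow> F y = k y t" "\<And>x. norm (F x) \<le> 2 * B"
    using kcont[of t] by (rule Tietze_complex[OF K closed_image, where e = B]) (use B k \<open>B \<ge> 0\<close> in auto)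
  then show ?thesis using that[of F] k by (auto simp: extends_def)
qed

lemma rational_constant: "e > 0 \<Longrightarrow> \<exists>a b. norm (c - Complex (of_rat a) (of_rat b)) \<le> e"
proof -
  assume "e > 0"
  obtain a b where "Complex (of_rat a) (of_rat b) \<in> ball c e"
    by (rule rational_point_in_open[of "ball c e" c]) (use \<open>e > 0\<close> in auto)
  then show ?thesis by (auto simp: dist_norm intro: less_imp_le)
qed

lemma alg_const_on_image:
  assumes "continuous_on UNIV f" "\<And>v. v \<in> X \<Longrightarrow> f (j v) = c"
  shows "f \<in> alg"
  unfolding alg_def
proof (intro CollectI conjI allI impI assms(1))
  fix e :: real assume "e > 0"
  then obtain a b where "norm (c - Complex (of_rat a) (of_rat b)) \<le> e" using rational_constant by blast
  then show "\<exists>t. \<forall>v\<in>X. norm (f (j v) - v t) \<le> e"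
    by (intro exI[of _ "Cst a b"]) (auto simp: assms(2) valuation_simps val)
qed

lemma separating_function:
  assumes "x \<notin> j ` X" "x \<noteq> y"
  obtains f where "f \<in> alg" "f x = 1" "f y = 0" "\<And>v. v \<in> X \<Longrightarrow> f (j v) = 0"
proof -
  have "closed (insert y (j ` X))" using closed_image by (rule closed_insert)
  then obtain u where u: "continuous_map euclidean euclideanreal u" "u ` insert y (j ` X) \<subseteq> {0}" "u ` {x} \<subseteq> {1}"
    using Urysohn_lemma_alt[OF normal_space_compact_t2[OF K], of "insert y (j ` X)" "{x}" 0 1] assms
    by (auto simp: closed_closedin[symmetric] disjnt_def)
  define f where "f x = complex_of_real (u x)" for x
  have c: "continuous_on UNIV f" unfolding f_def using u(1) by (auto intro!: continuous_intros)
  have z: "f (j v) = 0" if "v \<in> X" for v using u(2) that by (auto simp: f_def)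
  have "f x = 1" "f y = 0" using u by (auto simp: f_def)
  then show ?thesis using z by (intro that[of f] alg_const_on_image[OF c z]) auto
qed

lemma alg_iff_seq:
  "f \<in> alg \<longleftrightarrow> continuous_on UNIV f \<and> (\<exists>T. uniform_limit X (\<lambda>n v. v (T n)) (\<lambda>v. f (j v)) sequentially)"
proof (intro iffI conjI)
  assume f: "f \<in> alg"
  then show "continuous_on UNIV f" by (simp add: alg_def)
  have "\<forall>n. \<exists>t. \<forall>v\<in>X. norm (f (j v) - v t) \<le> 1 / real (Suc n)" using f by (simp add: alg_def)
  then obtain T where T: "\<And>n v. v \<in> X \<Longrightarrow> norm (f (j v) - v (T n)) \<le> 1 / real (Suc n)" by metis
  have "uniform_limit X (\<lambda>n v. v (T n)) (\<lambda>v. f (j v)) sequentially"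
  proof (rule uniform_limitI)
    fix e :: real assume "e > 0"
    then have "\<forall>\<^sub>F n in sequentially. 1 / real (Suc n) < e"
      using order_tendstoD(2)[OF LIMSEQ_inverse_real_of_nat] by (simp add: inverse_eq_divide)
    then show "\<forall>\<^sub>F n in sequentially. \<forall>v\<in>X. dist (v (T n)) (f (j v)) < e"
    proof eventually_elim
      case (elim n)
      show ?case using T[of _ n] elim by (auto simp: dist_norm norm_minus_commute intro: le_less_trans)
    qed
  qed
  then show "\<exists>T. uniform_limit X (\<lambda>n v. v (T n)) (\<lambda>v. f (j v)) sequentially" by blast
next
  assume "continuous_on UNIV f \<and> (\<exists>T. uniform_limit X (\<lambda>n v. v (T n)) (\<lambda>v. f (j v)) sequentially)"
  then obtain T where c: "continuous_on UNIV f"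
    and T: "uniform_limit X (\<lambda>n v. v (T n)) (\<lambda>v. f (j v)) sequentially" by blast
  show "f \<in> alg" unfolding alg_def
  proof (intro CollectI conjI allI impI c)
    fix e :: real assume "e > 0"
    then have "\<forall>\<^sub>F n in sequentially. \<forall>v\<in>X. dist (v (T n)) (f (j v)) < e" by (rule uniform_limitD[OF T])
    then obtain n where "\<forall>v\<in>X. dist (v (T n)) (f (j v)) < e"
      using eventually_happens'[OF sequentially_bot] by blast
    then show "\<exists>t. \<forall>v\<in>X. norm (f (j v) - v t) \<le> e"
      by (intro exI[of _ "T n"]) (auto simp: dist_norm norm_minus_commute intro: less_imp_le)
  qed
qed

section \<open>Extension of \<open>p\<close> to a character of \<open>alg\<close>\<close>

lemma p_diff:
  assumes "\<And>v. v \<in> X \<Longrightarrow> norm (v s - v t) \<le> M"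
  shows "norm (p s - p t) \<le> M"
proof -
  have d: "v (Add s (Mul (Cst (-1) 0) t)) = v s - v t" if "valuation v" for v
    using that by (simp add: valuation_simps complex_eq_iff of_rat_minus)
  have "norm (p (Add s (Mul (Cst (-1) 0) t))) \<le> M"
    by (rule p_bound) (use assms d val in auto)
  then show ?thesis using d[OF val_p] by simp
qed

text \<open>Extension of \<open>p\<close> by uniform continuity. For an \<open>f\<close> with no
  approximating sequence of terms the condition is vacuous and the value arbitrary.\<close>

definition eval_p :: "('a \<Rightarrow> complex) \<Rightarrow> complex" where
  "eval_p f = (SOME c. \<forall>T. uniform_limit X (\<lambda>n v. v (T n)) (\<lambda>v. f (j v)) sequentially \<longrightarrow> (\<lambda>n. p (T n)) \<longlonglongrightarrow> c)"

text \<open>On terms \<open>p\<close> is contractive for the supremum norm over \<open>X\<close>.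
  Hence uniformly convergent sequences of terms have Cauchy values, and two sequences with the same
  limit function have values with the same limit; this justifies \<open>SOME\<close>.\<close>

lemma eval_p_limit:
  assumes T: "uniform_limit X (\<lambda>n v. v (T n)) (\<lambda>v. f (j v)) sequentially"
  shows "(\<lambda>n. p (T n)) \<longlonglongrightarrow> eval_p f"
proof -
  have close: "\<forall>\<^sub>F n in sequentially. \<forall>v\<in>X. norm (v (S n) - f (j v)) \<le> e"
    if "e > 0" "uniform_limit X (\<lambda>n v. v (S n)) (\<lambda>v. f (j v)) sequentially" for S and e :: real
    using uniform_limitD[OF that(2,1)] by eventually_elim (auto simp: dist_norm intro: less_imp_le)
  have pair: "norm (p s - p t) \<le> 2 * e"
    if "\<forall>v\<in>X. norm (v s - f (j v)) \<le> e" "\<forall>v\<in>X. norm (v t - f (j v)) \<le> e" for s t e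
  proof (rule p_diff)
    fix v assume "v \<in> X"
    then show "norm (v s - v t) \<le> 2 * e"
      using that norm_triangle_ineq4[of "v s - f (j v)" "v t - f (j v)"] by fastforce
  qed
  have "Cauchy (\<lambda>n. p (T n))"
  proof (rule CauchyI)
    fix e :: real assume "e > 0"
    then obtain N where N: "\<And>n. n \<ge> N \<Longrightarrow> \<forall>v\<in>X. norm (v (T n) - f (j v)) \<le> e/3"
      using close[OF _ T, of "e/3"] by (auto simp: eventually_sequentially)
    have "norm (p (T m) - p (T n)) < e" if "m \<ge> N" "n \<ge> N" for m n
      using pair[OF N[OF that(1)] N[OF that(2)]] \<open>e > 0\<close> by linarith
    then show "\<exists>M. \<forall>m\<ge>M. \<forall>n\<ge>M. norm (p (T m) - p (T n)) < e" by blast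
  qed
  then obtain c where c: "(\<lambda>n. p (T n)) \<longlonglongrightarrow> c" by (auto simp: Cauchy_convergent_iff convergent_def)
  have "(\<lambda>n. p (S n)) \<longlonglongrightarrow> c" if S: "uniform_limit X (\<lambda>n v. v (S n)) (\<lambda>v. f (j v)) sequentially" for S
  proof -
    have "(\<lambda>n. p (S n) - p (T n)) \<longlonglongrightarrow> 0"
    proof (rule tendstoI)
      fix e :: real assume "e > 0"
      then have "e/3 > 0" by simp
      from close[OF this S] close[OF this T] show "\<forall>\<^sub>F n in sequentially. dist (p (S n) - p (T n)) 0 < e"
      proof eventually_elim
        case (elim n)
        then show ?case using pair[OF elim] \<open>e > 0\<close> by simp
      qed
    qed
    from tendsto_add[OF this c] show ?thesis by simp
  qed
  then have "\<exists>c. \<forall>T. uniform_limit X (\<lambda>n v. v (T n)) (\<lambda>v. f (j v)) sequentially \<longrightarrow> (\<lambda>n. p (T n)) \<longlonglongrightarrow> c"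
    by blast
  from someI_ex[OF this] T show ?thesis unfolding eval_p_def by blast
qed

lemma extends_limit: "extends f t \<Longrightarrow> uniform_limit X (\<lambda>n v. v t) (\<lambda>v. f (j v)) sequentially"
  by (rule uniform_limitI) (auto simp: extends_def)

lemma eval_p_extends: "extends f t \<Longrightarrow> eval_p f = p t"
  using LIMSEQ_unique[OF eval_p_limit[of "\<lambda>_. t" f] tendsto_const] extends_limit[of f t] by simp

lemma alg_add_mult:
  assumes "f \<in> alg" "g \<in> alg"
  shows "(\<lambda>x. f x + g x) \<in> alg" "(\<lambda>x. f x * g x) \<in> alg"
    "eval_p (\<lambda>x. f x + g x) = eval_p f + eval_p g" "eval_p (\<lambda>x. f x * g x) = eval_p f * eval_p g"
proof -
  have c: "continuous_on UNIV f" "continuous_on UNIV g" using assms by (auto simp: alg_def)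
  obtain S where S: "uniform_limit X (\<lambda>n v. v (S n)) (\<lambda>v. f (j v)) sequentially" using assms(1) alg_iff_seq by blast
  obtain T where T: "uniform_limit X (\<lambda>n v. v (T n)) (\<lambda>v. g (j v)) sequentially" using assms(2) alg_iff_seq by blast
  have bd: "bounded ((\<lambda>v. h (j v)) ` X)" if "continuous_on UNIV h" for h :: "'a \<Rightarrow> complex"
    by (intro compact_imp_bounded compact_continuous_image X continuous_on_compose2[OF that j(1)]) auto
  have "uniform_limit X (\<lambda>n v. v (S n) + v (T n)) (\<lambda>v. f (j v) + g (j v)) sequentially"
    by (rule uniform_limit_add[OF S T])
  moreover have "v (S n) + v (T n) = v (Add (S n) (T n))" if "v \<in> X" for v n
    using val[OF that] by (simp add: valuation_simps)
  ultimately have add: "uniform_limit X (\<lambda>n v. v (Add (S n) (T n))) (\<lambda>v. f (j v) + g (j v)) sequentially"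
    by (subst (asm) uniform_limit_cong') auto
  have "uniform_limit X (\<lambda>n v. v (S n) * v (T n)) (\<lambda>v. f (j v) * g (j v)) sequentially"
    by (rule uniform_lim_mult[OF S T bd[OF c(1)] bd[OF c(2)]])
  moreover have "v (S n) * v (T n) = v (Mul (S n) (T n))" if "v \<in> X" for v n
    using val[OF that] by (simp add: valuation_simps)
  ultimately have mul: "uniform_limit X (\<lambda>n v. v (Mul (S n) (T n))) (\<lambda>v. f (j v) * g (j v)) sequentially"
    by (subst (asm) uniform_limit_cong') auto
  have ca: "continuous_on UNIV (\<lambda>x. f x + g x)" and cm: "continuous_on UNIV (\<lambda>x. f x * g x)"
    by (rule continuous_on_add[OF c], rule continuous_on_mult[OF c])
  show "(\<lambda>x. f x + g x) \<in> alg"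
    unfolding alg_iff_seq by (intro conjI ca exI[of _ "\<lambda>n. Add (S n) (T n)"] add)
  show "(\<lambda>x. f x * g x) \<in> alg"
    unfolding alg_iff_seq by (intro conjI cm exI[of _ "\<lambda>n. Mul (S n) (T n)"] mul)
  have lim: "(\<lambda>n. p (S n)) \<longlonglongrightarrow> eval_p f" "(\<lambda>n. p (T n)) \<longlonglongrightarrow> eval_p g"
    by (intro eval_p_limit S T)+
  have "(\<lambda>n. p (Add (S n) (T n))) \<longlonglongrightarrow> eval_p f + eval_p g"
    using tendsto_add[OF lim] by (simp add: valuation_simps val_p)
  moreover have "(\<lambda>n. p (Add (S n) (T n))) \<longlonglongrightarrow> eval_p (\<lambda>x. f x + g x)"
    by (rule eval_p_limit[OF add])
  ultimately show "eval_p (\<lambda>x. f x + g x) = eval_p f + eval_p g" using LIMSEQ_unique by blast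
  have "(\<lambda>n. p (Mul (S n) (T n))) \<longlonglongrightarrow> eval_p f * eval_p g"
    using tendsto_mult[OF lim] by (simp add: valuation_simps val_p)
  moreover have "(\<lambda>n. p (Mul (S n) (T n))) \<longlonglongrightarrow> eval_p (\<lambda>x. f x * g x)"
    by (rule eval_p_limit[OF mul])
  ultimately show "eval_p (\<lambda>x. f x * g x) = eval_p f * eval_p g" using LIMSEQ_unique by blast
qed

lemma const_in_alg: "(\<lambda>_. c) \<in> alg"
  by (rule alg_const_on_image) auto

lemma eval_p_const: "eval_p (\<lambda>_. c) = c"
proof -
  obtain T where T: "uniform_limit X (\<lambda>n v. v (T n)) (\<lambda>v. c) sequentially"
    \<comment> \<open>Stated for all valuations, because it is applied to \<open>p\<close>, which is
      not in \<open>X\<close>.\<close>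
    and eq: "\<And>v n. valuation v \<Longrightarrow> norm (v (T n) - c) \<le> 1 / real (Suc n)"
  proof -
    have "\<forall>n. \<exists>a b. norm (c - Complex (of_rat a) (of_rat b)) \<le> 1 / real (Suc n)"
      by (intro allI rational_constant) auto
    then obtain a b where ab: "\<And>n. norm (c - Complex (of_rat (a n)) (of_rat (b n))) \<le> 1 / real (Suc n)" by metis
    have v: "norm (v (Cst (a n) (b n)) - c) \<le> 1 / real (Suc n)" if "valuation v" for v n
      using ab[of n] by (simp only: valuation_simps[OF that] norm_minus_commute)
    have "uniform_limit X (\<lambda>n v. v (Cst (a n) (b n))) (\<lambda>v. c) sequentially"
    proof (rule uniform_limitI)
      fix e :: real assume "e > 0"
      then have "\<forall>\<^sub>F n in sequentially. 1 / real (Suc n) < e"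
        using order_tendstoD(2)[OF LIMSEQ_inverse_real_of_nat] by (simp add: inverse_eq_divide)
      then show "\<forall>\<^sub>F n in sequentially. \<forall>x\<in>X. dist (x (Cst (a n) (b n))) c < e"
        by eventually_elim (use v val in \<open>auto simp: dist_norm intro: le_less_trans\<close>)
    qed
    then show ?thesis using v by (intro that[of "\<lambda>n. Cst (a n) (b n)"]) auto
  qed
  have "(\<lambda>n. p (T n)) \<longlonglongrightarrow> eval_p (\<lambda>_. c)" by (rule eval_p_limit[OF T])
  moreover have "(\<lambda>n. p (T n)) \<longlonglongrightarrow> c"
  proof (rule LIM_zero_cancel, rule Lim_null_comparison)
    show "\<forall>\<^sub>F n in sequentially. norm (p (T n) - c) \<le> 1 / real (Suc n)" using eq[OF val_p] by simp
    show "(\<lambda>n. 1 / real (Suc n)) \<longlonglongrightarrow> 0"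
      using LIMSEQ_inverse_real_of_nat by (simp add: inverse_eq_divide)
  qed
  ultimately show ?thesis using LIMSEQ_unique by blast
qed

lemma uniform_algebra_alg: "uniform_algebra alg"
  unfolding uniform_algebra_def
proof (intro conjI allI ballI impI)
  show "continuous_on UNIV f" if "f \<in> alg" for f using that by (simp add: alg_def)
  show "(\<lambda>_. c) \<in> alg" for c by (rule const_in_alg)
  show "(\<lambda>x. f x + g x) \<in> alg" if "f \<in> alg" "g \<in> alg" for f g by (rule alg_add_mult(1)[OF that])
  show "(\<lambda>x. f x * g x) \<in> alg" if "f \<in> alg" "g \<in> alg" for f g by (rule alg_add_mult(2)[OF that])
  show "(\<lambda>x. c * f x) \<in> alg" if "f \<in> alg" for c f by (rule alg_add_mult(2)[OF const_in_alg that])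
next
  fix F :: "nat \<Rightarrow> 'a \<Rightarrow> complex" and g
  assume Fg: "(\<forall>n. F n \<in> alg) \<and> uniform_limit UNIV F g sequentially"
  have c: "continuous_on UNIV g"
    by (rule uniform_limit_theorem[where f = F]) (use Fg in \<open>auto simp: alg_def\<close>)
  show "g \<in> alg" unfolding alg_def
  proof (intro CollectI conjI allI impI c)
    fix e :: real assume "e > 0"
    then have "\<forall>\<^sub>F n in sequentially. \<forall>x\<in>UNIV. dist (F n x) (g x) < e/2"
      using Fg by (intro uniform_limitD) auto
    then obtain n where n: "\<And>x. dist (F n x) (g x) < e/2"
      using eventually_happens'[OF sequentially_bot] by fastforce
    have "F n \<in> alg" "e/2 > 0" using Fg \<open>e > 0\<close> by auto
    then obtain t where t: "\<And>v. v \<in> X \<Longrightarrow> norm (F n (j v) - v t) \<le> e/2" unfolding alg_def by blast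
    have "norm (g (j v) - v t) \<le> e" if "v \<in> X" for v
      using norm_triangle_ineq[of "g (j v) - F n (j v)" "F n (j v) - v t"] n[of "j v"] t[OF that]
      by (simp add: dist_norm norm_minus_commute)
    then show "\<exists>t. \<forall>v\<in>X. norm (g (j v) - v t) \<le> e" by blast
  qed
next
  fix x y :: 'a assume xy: "x \<noteq> y"
  show "\<exists>f\<in>alg. f x \<noteq> f y"
  proof (cases "x \<in> j ` X \<and> y \<in> j ` X")
    case True
    then obtain v w where vw: "v \<in> X" "w \<in> X" "x = j v" "y = j w" by blast
    then have "v \<noteq> w" using xy by blast
    then obtain t where t: "v t \<noteq> w t" by blast
    obtain f where "extends f t" by (rule exists_extends)
    then show ?thesis using extends_in_alg[of f t] vw t by (intro bexI[of _ f]) (auto simp: extends_def)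
  next
    case False
    then consider "x \<notin> j ` X" | "y \<notin> j ` X" by blast
    then show ?thesis
    proof cases
      case 1
      then obtain f where "f \<in> alg" "f x = 1" "f y = 0" by (rule separating_function[OF _ xy])
      then show ?thesis by (intro bexI[of _ f]) auto
    next
      case 2
      then obtain f where "f \<in> alg" "f y = 1" "f x = 0" by (rule separating_function[OF _ xy[symmetric]])
      then show ?thesis by (intro bexI[of _ f]) auto
    qed
  qed
qed

lemma character_eval_p: "character alg eval_p"
  unfolding character_def
proof (intro conjI ballI allI)
  show "eval_p (\<lambda>x. c * f x) = c * eval_p f" if "f \<in> alg" for c f
    using alg_add_mult(4)[OF const_in_alg[of c] that] by (simp add: eval_p_const)
  show "\<exists>f\<in>alg. eval_p f \<noteq> 0"
    by (rule bexI[of _ "\<lambda>_. 1"]) (simp_all add: eval_p_const const_in_alg)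
qed (rule alg_add_mult; assumption)+

text \<open>At a point \<open>j v\<close> it would follow that \<open>p = v\<close>, as every
  coordinate has an extension in \<open>alg\<close>. At any other point a function that is 1 there
  and 0 on the image of \<open>j\<close> refutes the claim, since \<open>eval_p\<close> depends only
  on values on that image.\<close>

lemma eval_p_not_point_evaluation: "\<not> is_point_evaluation alg eval_p"
proof
  assume "is_point_evaluation alg eval_p"
  then obtain x where x: "\<And>f. f \<in> alg \<Longrightarrow> eval_p f = f x" by (auto simp: is_point_evaluation_def)
  show False
  proof (cases "x \<in> j ` X")
    case True
    then obtain v where v: "v \<in> X" "x = j v" by blast
    have "p t = v t" for t
    proof -
      obtain f where f: "extends f t" by (rule exists_extends)
      then show ?thesis using eval_p_extends[OF f] x[OF extends_in_alg[OF f]] v by (simp add: extends_def)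
    qed
    then have "p = v" by blast
    then show False using v p_notin by simp
  next
    case False
    obtain v where v: "v \<in> X" using X_nonempty by blast
    then have "x \<noteq> j v" using False by blast
    then obtain f where f: "f \<in> alg" "f x = 1" "\<And>v. v \<in> X \<Longrightarrow> f (j v) = 0"
      using separating_function[OF False] by blast
    have "extends f (Cst 0 0)"
      using f val by (auto simp: extends_def alg_def valuation_simps complex_eq_iff)
    then have "eval_p f = 0" using eval_p_extends val_p by (simp add: valuation_simps complex_eq_iff)
    then show False using x[OF f(1)] f(2) by simp
  qed
qed

text \<open>The functions vanishing on \<open>j ` X\<close> form an ideal on which a disc is constant, because real ones
  take real values, hence zero, because otherwise the disc would be constant on the whole algebra.
  So a disc only sees the terms, where infinitely divisible orders of zeros rule it out.\<close>

lemma no_analytic_disc: "\<not> analytic_disc alg \<sigma>"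
proof
  assume disc: "analytic_disc alg \<sigma>"
  let ?D = "ball (0::complex) 1"
  note ua = uniform_algebra_alg
  have ch: "character alg (\<sigma> z)" if "z \<in> ?D" for z using disc that by (simp add: analytic_disc_def)
  have hol: "(\<lambda>z. \<sigma> z f) holomorphic_on ?D" if "f \<in> alg" for f using disc that by (simp add: analytic_disc_def)
  have sep: "\<exists>f\<in>alg. \<sigma> z f \<noteq> \<sigma> w f" if "z \<in> ?D" "w \<in> ?D" "z \<noteq> w" for z w
    using disc that by (simp add: analytic_disc_def)
  have const: "\<sigma> z (\<lambda>_. c) = c" if "z \<in> ?D" for z c by (rule character_const[OF ua ch[OF that]])
  have D0: "0 \<in> ?D" by simp
  have real_const: "\<sigma> z (\<lambda>x. of_real (f x)) = \<sigma> 0 (\<lambda>x. of_real (f x))"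
    if f: "continuous_on UNIV f" "\<And>v. v \<in> X \<Longrightarrow> f (j v) = 0" and z: "z \<in> ?D" for f :: "'a \<Rightarrow> real" and z
  proof -
    define g where "g x = complex_of_real (f x)" for x
    have gc: "continuous_on UNIV g" unfolding g_def by (intro continuous_intros f(1))
    have g: "g \<in> alg" by (rule alg_const_on_image[OF gc, of 0]) (simp add: g_def f(2))
    have im: "Im (\<sigma> w g) = 0" if w: "w \<in> ?D" for w
    proof (rule ccontr)
      assume nz: "Im (\<sigma> w g) \<noteq> 0"
      define l where "l = \<sigma> w g"
      have ne: "g x + - l \<noteq> 0" for x
      proof
        assume "g x + - l = 0"
        then have "Im (g x) = Im l" by (simp add: add_eq_0_iff)
        then show False using nz by (simp add: g_def l_def)
      qed
      \<comment> \<open>\<open>g - l\<close> has no zero, as \<open>g\<close> is real and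
        \<open>l\<close> is not. Its reciprocal is constant on the image of \<open>j\<close>, hence
        lies in \<open>alg\<close>, so no character can kill \<open>g - l\<close>.\<close>
      define h where "h x = 1 / (g x + - l)" for x
      have hc: "continuous_on UNIV h" unfolding h_def by (intro continuous_intros gc) (use ne in auto)
      have h: "h \<in> alg" by (rule alg_const_on_image[OF hc, of "1 / (0 + - l)"]) (simp add: h_def g_def f(2))
      have gl: "(\<lambda>x. g x + (\<lambda>_. - l) x) \<in> alg" by (rule alg_add_mult(1)[OF g const_in_alg])
      have "\<sigma> w (\<lambda>x. g x + (\<lambda>_. - l) x) = \<sigma> w g + \<sigma> w (\<lambda>_. - l)"
        by (rule characterD(1)[OF ch[OF w] g const_in_alg])
      then have "\<sigma> w (\<lambda>x. g x + (\<lambda>_. - l) x) = 0" using const[OF w] by (simp add: l_def)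
      moreover have "\<sigma> w (\<lambda>x. h x * (\<lambda>x. g x + (\<lambda>_. - l) x) x) = \<sigma> w h * \<sigma> w (\<lambda>x. g x + (\<lambda>_. - l) x)"
        by (rule characterD(2)[OF ch[OF w] h gl])
      moreover have "(\<lambda>x. h x * (\<lambda>x. g x + (\<lambda>_. - l) x) x) = (\<lambda>_. 1)"
        using ne by (simp add: h_def)
      ultimately have "\<sigma> w (\<lambda>_. 1) = 0" by simp
      then show False using const[OF w] by simp
    qed
    have "(\<lambda>w. \<sigma> w g) constant_on ?D" by (rule real_holomorphic_constant[OF hol[OF g] im])
    then show ?thesis using z D0 unfolding constant_on_def g_def by metis
  qed
  have ideal_const: "\<sigma> z f = \<sigma> 0 f"
    if f: "continuous_on UNIV f" "\<And>v. v \<in> X \<Longrightarrow> f (j v) = 0" and z: "z \<in> ?D" for f z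
  proof -
    define R where "R x = complex_of_real (Re (f x))" for x
    define I where "I x = complex_of_real (Im (f x))" for x
    have RI: "continuous_on UNIV R" "continuous_on UNIV I"
      unfolding R_def I_def by (intro continuous_intros f(1))+
    have R: "R \<in> alg" by (rule alg_const_on_image[OF RI(1), of 0]) (simp add: R_def f(2))
    have I: "I \<in> alg" by (rule alg_const_on_image[OF RI(2), of 0]) (simp add: I_def f(2))
    have iI: "(\<lambda>x. \<i> * I x) \<in> alg" by (rule uniform_algebraD(5)[OF ua I])
    have feq: "f = (\<lambda>x. R x + (\<lambda>x. \<i> * I x) x)"
      by (auto simp: R_def I_def complex_eq_iff fun_eq_iff)
    have dec: "\<sigma> w f = \<sigma> w R + \<i> * \<sigma> w I" if "w \<in> ?D" for w
      by (subst feq) (simp only: characterD(1)[OF ch[OF that] R iI] characterD(3)[OF ch[OF that] I])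
    have "\<sigma> z R = \<sigma> 0 R" unfolding R_def by (rule real_const[OF _ _ z]) (auto intro!: continuous_intros f(1) simp: f(2))
    moreover have "\<sigma> z I = \<sigma> 0 I" unfolding I_def by (rule real_const[OF _ _ z]) (auto intro!: continuous_intros f(1) simp: f(2))
    ultimately show ?thesis using dec[OF z] dec[OF D0] by simp
  qed
  have ideal_zero: "\<sigma> z f = 0"
    if f: "continuous_on UNIV f" "\<And>v. v \<in> X \<Longrightarrow> f (j v) = 0" and z: "z \<in> ?D" for f z
  proof (rule ccontr)
    assume "\<sigma> z f \<noteq> 0"
    then have nz: "\<sigma> 0 f \<noteq> 0" using ideal_const[OF f z] by simp
    have fa: "f \<in> alg" by (rule alg_const_on_image[OF f])
    have "(1/2 :: complex) \<in> ?D" by simp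
    then obtain g where g: "g \<in> alg" "\<sigma> 0 g \<noteq> \<sigma> (1/2) g" using sep[of 0 "1/2"] by auto
    have gc: "continuous_on UNIV g" by (rule uniform_algebraD(1)[OF ua g(1)])
    \<comment> \<open>Both \<open>f\<close> and \<open>f * g\<close> vanish on the image of
      \<open>j\<close>, so the disc is constant on both; cancelling the nonzero value on
      \<open>f\<close> gives \<open>g\<close> equal values at 0 and \<open>1/2\<close>, against its
      choice.\<close>
    have "\<sigma> (1/2) (\<lambda>x. f x * g x) = \<sigma> 0 (\<lambda>x. f x * g x)"
      by (rule ideal_const) (auto intro!: continuous_intros f gc simp: f(2))
    then have "\<sigma> (1/2) f * \<sigma> (1/2) g = \<sigma> 0 f * \<sigma> 0 g"
      using characterD(2)[OF ch fa g(1)] \<open>1/2 \<in> ?D\<close> D0 by metis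
    then show False using ideal_const[OF f \<open>1/2 \<in> ?D\<close>] nz g(2) by simp
  qed
  have same: "\<sigma> z f = \<sigma> z g" if fg: "f \<in> alg" "g \<in> alg" "\<And>v. v \<in> X \<Longrightarrow> f (j v) = g (j v)" and z: "z \<in> ?D" for f g z
  proof -
    have c: "continuous_on UNIV f" "continuous_on UNIV g" using uniform_algebraD(1)[OF ua] fg by auto
    have d: "\<sigma> z (\<lambda>x. f x - g x) = 0"
      by (rule ideal_zero[OF _ _ z]) (auto intro!: continuous_intros c simp: fg(3))
    have da: "(\<lambda>x. f x - g x) \<in> alg"
      by (rule alg_const_on_image[where c = 0]) (auto intro!: continuous_intros c simp: fg(3))
    have "\<sigma> z (\<lambda>x. (\<lambda>x. f x - g x) x + g x) = \<sigma> z (\<lambda>x. f x - g x) + \<sigma> z g"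
      by (rule characterD(1)[OF ch[OF z] da fg(2)])
    then show ?thesis using d by simp
  qed
  have "\<forall>t. \<exists>f. extends f t" using exists_extends by blast
  then obtain L where L: "\<And>t. extends (L t) t" by metis
  have La: "L t \<in> alg" for t by (rule extends_in_alg[OF L])
  have Lv: "L t (j v) = v t" if "v \<in> X" for t v using L[of t] that by (simp add: extends_def)
  \<comment> \<open>By \<open>same\<close> the choice of the extension \<open>L t\<close> is
    immaterial, so \<open>H\<close> inherits relations that hold between terms on
    \<open>X\<close>.\<close>
  define H where "H t z = \<sigma> z (L t)" for t z
  have Hhol: "H t holomorphic_on ?D" for t unfolding H_def by (rule hol[OF La])
  have Hroot: "(H (Rt t) z)\<^sup>2 = H t z" if z: "z \<in> ?D" for t z
  proof -
    have "\<sigma> z (\<lambda>x. L (Rt t) x * L (Rt t) x) = \<sigma> z (L t)"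
      by (rule same[OF alg_add_mult(2)[OF La La] La _ z])
         (use valuation_simps(4)[OF val] in \<open>auto simp: Lv power2_eq_square\<close>)
    then show ?thesis by (simp add: H_def characterD(2)[OF ch[OF z] La La] power2_eq_square)
  qed
  have Hshift: "H (Add t (Cst a b)) z = H t z + Complex (of_rat a) (of_rat b)" if z: "z \<in> ?D" for t a b z
  proof -
    have "\<sigma> z (L (Add t (Cst a b))) = \<sigma> z (\<lambda>x. L t x + (\<lambda>_. Complex (of_rat a) (of_rat b)) x)"
      by (rule same[OF La alg_add_mult(1)[OF La const_in_alg] _ z])
         (auto simp: Lv valuation_simps[OF val])
    also have "\<dots> = \<sigma> z (L t) + \<sigma> z (\<lambda>_. Complex (of_rat a) (of_rat b))"
      by (rule characterD(1)[OF ch[OF z] La const_in_alg])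
    finally show ?thesis using const[OF z] by (simp add: H_def)
  qed
  have Hconst: "H t z = H t w" if zw: "z \<in> ?D" "w \<in> ?D" for t z w
  proof (rule ccontr)
    assume ne: "H t z \<noteq> H t w"
    then have "\<not> H t constant_on ?D" using zw unfolding constant_on_def by metis
    then have "open (H t ` ?D)" by (intro open_mapping_thm[OF Hhol]) auto
    \<comment> \<open>The value to be subtracted must be complex rational to stay within the terms;
      the open image of a nonconstant \<open>H t\<close> contains one.\<close>
    then obtain a b where "Complex (of_rat a) (of_rat b) \<in> H t ` ?D"
      using rational_point_in_open[of "H t ` ?D" "H t 0"] D0 by blast
    then obtain u where u: "u \<in> ?D" "H t u = Complex (of_rat a) (of_rat b)" by auto
    define s where "s = Add t (Cst (-a) (-b))"
    have Hs: "H s y = H t y - Complex (of_rat a) (of_rat b)" if "y \<in> ?D" for y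
      unfolding s_def Hshift[OF that] by (simp add: of_rat_minus complex_eq_iff)
    have "H s y = 0" if "y \<in> ?D" for y
      by (rule zero_of_iterated_roots[of ?D u H Rt]) (use that u Hs Hhol Hroot in auto)
    then have "H s z = 0" "H s w = 0" using zw by auto
    then show False using ne Hs zw by simp
  qed
  have all_const: "\<sigma> z f = \<sigma> w f" if f: "f \<in> alg" and zw: "z \<in> ?D" "w \<in> ?D" for f z w
  proof (rule ccontr)
    assume ne: "\<sigma> z f \<noteq> \<sigma> w f"
    \<comment> \<open>Each of the two values moves by at most \<open>e\<close> on passing to a term,
      on which the disc is constant; a distance of \<open>3 * e\<close> cannot be bridged in this
      way.\<close>
    define e where "e = norm (\<sigma> z f - \<sigma> w f) / 3"
    have e: "e > 0" using ne by (simp add: e_def)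
    obtain F t where F: "extends F t" "\<And>x. norm (f x - F x) \<le> e" using approx_extends[OF f e] by blast
    have Fa: "F \<in> alg" by (rule extends_in_alg[OF F(1)])
    have mF: "(\<lambda>x. (-1) * F x) \<in> alg" by (rule uniform_algebraD(5)[OF ua Fa])
    have bound: "norm (\<sigma> y f - H t y) \<le> e" if y: "y \<in> ?D" for y
    proof -
      have "\<sigma> y F = H t y" unfolding H_def
        by (rule same[OF Fa La _ y]) (use F(1) in \<open>auto simp: Lv extends_def\<close>)
      moreover have "\<sigma> y (\<lambda>x. f x + (\<lambda>x. (-1) * F x) x) = \<sigma> y f + (-1) * \<sigma> y F"
        by (simp only: characterD(1)[OF ch[OF y] f mF] characterD(3)[OF ch[OF y] Fa])
      moreover have "norm (\<sigma> y (\<lambda>x. f x + (\<lambda>x. (-1) * F x) x)) \<le> e"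
        by (rule character_norm_le[OF ua ch[OF y] alg_add_mult(1)[OF f mF]]) (use F(2) in auto)
      ultimately show ?thesis by simp
    qed
    have "norm (\<sigma> z f - \<sigma> w f) \<le> e + e"
      using norm_triangle_ineq4[of "\<sigma> z f - H t z" "\<sigma> w f - H t w"] bound[OF zw(1)] bound[OF zw(2)]
        Hconst[OF zw, of t] by simp
    then show False using e by (simp add: e_def)
  qed
  show False using sep[of 0 "1/2"] all_const[of _ 0 "1/2"] by auto
qed

end

theorem theorem1p8:
  assumes "compact (UNIV :: 'a::t2_space set)"
    and "\<exists>C :: 'a set. C homeomorphic cantor_set"
  shows "\<exists>A :: ('a \<Rightarrow> complex) set. uniform_algebra A \<and>
           (\<exists>\<phi>. character A \<phi> \<and> \<not> is_point_evaluation A \<phi>) \<and>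
           \<not> (\<exists>\<sigma>. analytic_disc A \<sigma>)"
proof -
  obtain X :: "(trm \<Rightarrow> complex) set" and p
    where X: "compact X" "totally_disconnected X" "\<forall>v\<in>X. valuation v" "valuation p" "p \<notin> X"
      "\<forall>t M. (\<forall>v\<in>X. norm (v t) \<le> M) \<longrightarrow> norm (p t) \<le> M"
    by (rule exists_nontrivial_valuation)
  obtain c :: "(trm \<Rightarrow> complex) \<Rightarrow> real" where c: "continuous_on X c" "inj_on c X" "c ` X \<subseteq> cantor_set"
    by (rule embed_in_cantor_set[OF X(1,2)])
  obtain C :: "'a set" and k h where h: "homeomorphism C cantor_set k h"
    using assms(2) by (auto simp: homeomorphic_def)
  define j where "j v = h (c v)" for v
  have jc: "continuous_on X j" unfolding j_def
    by (rule continuous_on_compose2[OF homeomorphism_cont2[OF h] c(1,3)])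
  have "inj_on h cantor_set" by (rule inj_on_inverseI[of _ k]) (rule homeomorphism_apply2[OF h])
  then have ji: "inj_on j X" unfolding j_def
    using comp_inj_on[OF c(2) inj_on_subset[OF _ c(3)]] by (simp add: o_def)
  interpret embedded_spectrum X p j
    by unfold_locales (use assms(1) X jc ji in auto)
  show ?thesis
    using uniform_algebra_alg character_eval_p eval_p_not_point_evaluation no_analytic_disc by blast
qed

end
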